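(* Let $k\equiv0\pmod4$ be a positive integer and $m\ge1$. Let $f=E_k(\tau)=1+\frac{(2\pi)^k}{\zeta(k)\Gamma(k)}\sum_{n\ge1}\sigma_{k-1}(n)e^{2\pi in\tau}$, let $\Lambda_f(s)=(2\pi)^{-s}\Gamma(s)L_f(s)$ (meromorphically continued), and let $\widetilde\Lambda_f(s):=\Lambda_f(s)/\cos(\pi s/2)$. Then all zeros of $$P_f^m(z):=\sum_{\substack{n=1\\ n\text{ odd}}}^{k-3}\binom{k-2}{n}i^{1-n}\widetilde\Lambda_f^{(m)}(n+1)z^{k-3-n}$$ lie on the unit circle.
   Context: $\sigma_{k-1}(n)=\sum_{d\mid n}d^{k-1}$; for $f=\sum a_ne^{2\pi in\tau}$, $L_f(s)=\sum_{n\ge1}a_nn^{-s}$. For $f=E_k$ one has $L_f(s)=c\,\zeta(s)\zeta(s-k+1)$ for a constant $c$, and $\widetilde\Lambda_f$ is meromorphic on $\mathbb C$ (holomorphic at even integers $2\le s\le k-2$); $\widetilde\Lambda_f^{(m)}$ denotes its $m$-th derivative.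
   Formalization: The case k = 4 with m odd is excluded: there the symmetry s ↦ 4 − s gives Λ̃_f^{(m)}(2) = 0, so P_f^m is identically zero and every z is a zero, making the claim as stated false. *)

theory Defs
  imports "HOL-Complex_Analysis.Complex_Analysis" "HOL-Number_Theory.Cong"
begin

definition divisor_sigma :: "nat \<Rightarrow> nat \<Rightarrow> nat" where
  "divisor_sigma r n = (\<Sum>d | d dvd n. d ^ r)"

text \<open>The Riemann zeta function at integers \<open>k \<ge> 2\<close>, as a convergent series.\<close>

definition zeta_nat :: "nat \<Rightarrow> real" where
  "zeta_nat k = (\<Sum>n. 1 / real (Suc n) ^ k)"

text \<open>
  The sign of the nonconstant part is the one for \<open>4 dvd k\<close>; for general even weight the
  Eisenstein series carries a factor \<open>\<i> ^ k\<close> there.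
\<close>

definition eisenstein_E :: "nat \<Rightarrow> complex \<Rightarrow> complex" where
  "eisenstein_E k \<tau> =
     1 + of_real ((2 * pi) ^ k / (zeta_nat k * Gamma (real k))) *
         (\<Sum>n. of_nat (divisor_sigma (k - 1) (Suc n)) *
               exp (2 * of_real pi * \<i> * of_nat (Suc n) * \<tau>))"

text \<open>The expansion determines the coefficients, since it is a power series in
  \<open>exp (2 * pi * \<i> * \<tau>)\<close>, which takes every value in the punctured unit disc.\<close>

definition fourier_coeff :: "(complex \<Rightarrow> complex) \<Rightarrow> nat \<Rightarrow> complex" where
  "fourier_coeff f = (THE a. \<forall>\<tau>. Im \<tau> > 0 \<longrightarrow>
     (\<lambda>n. a n * exp (2 * of_real pi * \<i> * of_nat n * \<tau>)) sums f \<tau>)"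

definition L_series :: "(complex \<Rightarrow> complex) \<Rightarrow> complex \<Rightarrow> complex" where
  "L_series f s = (\<Sum>n. fourier_coeff f (Suc n) * of_nat (Suc n) powr (-s))"

text \<open>
  The meromorphic continuation to the whole plane of a function given on some right half-plane.
  By the identity theorem it is unique if it exists, and does not depend on the half-plane:
  \<open>nicely_meromorphic_on\<close> fixes the values at removable singularities and at poles.
\<close>

definition meromorphic_continuation :: "(complex \<Rightarrow> complex) \<Rightarrow> complex \<Rightarrow> complex" where
  "meromorphic_continuation F = (THE G. G nicely_meromorphic_on UNIV \<and>
     (\<exists>c::real. \<forall>s. Re s > c \<longrightarrow> G s = F s))"

definition completed_L :: "(complex \<Rightarrow> complex) \<Rightarrow> complex \<Rightarrow> complex" where
  "completed_L f =
     meromorphic_continuation (\<lambda>s. of_real (2 * pi) powr (-s) * Gamma s * L_series f s)"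

text \<open>At the zeros of the cosine, the odd integers, this takes the value 0 by the convention
  for division; it is only used near even integers.\<close>

definition completed_L_tilde :: "(complex \<Rightarrow> complex) \<Rightarrow> complex \<Rightarrow> complex" where
  "completed_L_tilde f s = completed_L f s / cos (of_real pi * s / 2)"

definition period_poly_deriv :: "(complex \<Rightarrow> complex) \<Rightarrow> nat \<Rightarrow> nat \<Rightarrow> complex \<Rightarrow> complex" where
  "period_poly_deriv f k m z =
     (\<Sum>n | n \<in> {1..k - 3} \<and> odd n.
        of_nat ((k - 2) choose n) * \<i> powi (1 - int n) *
        (deriv ^^ m) (completed_L_tilde f) (of_nat (n + 1)) * z ^ (k - 3 - n))"

end

theory Submission
  imports Defs "HOL-Computational_Algebra.Fundamental_Theorem_Algebra"
begin

text \<open>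
  The functional equation of the zeta function turns \<open>\<Lambda>(s) / cos (\<pi> s / 2)\<close> into a constant multiple
  of \<open>p(s) h(s)\<close> with \<open>p(s) = \<Gamma>(s) \<Gamma>(k - s)\<close> and \<open>h(s) = \<zeta>(s) \<zeta>(k - s)\<close>, on the strip
  \<open>1 < Re s < k - 1\<close>. The binomial coefficient in the polynomial is \<open>(k - 2)! / p(n + 1)\<close>, so up to a
  constant the coefficients are the values of \<open>F\<^sub>m = (p h)\<^bsup>(m)\<^esup> / p\<close> at even integers. With
  \<open>L = p' / p = \<psi>(s) - \<psi>(k - s)\<close> one has \<open>F\<^sub>0 = h\<close> and \<open>F\<^sub>m\<^sub>+\<^sub>1 = F\<^sub>m' + L F\<^sub>m\<close>. Both \<open>h\<close> and \<open>L\<close> have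
  nonnegative Taylor coefficients at the centre \<open>k / 2\<close>, hence so has every \<open>F\<^sub>m\<close>: it is nonnegative and
  nondecreasing to the right of \<open>k / 2\<close>, and even or odd under \<open>s \<mapsto> k - s\<close>. As a polynomial in
  \<open>- z\<^sup>2\<close> the period polynomial is thus (anti)palindromic with coefficients increasing from the middle,
  and the theorem of Enestroem and Kakeya forces its zeros onto the unit circle.
\<close>

section \<open>Palindromic polynomials\<close>

text \<open>The coefficients are known to be nonnegative and increasing only from the middle
  upwards, so Enestroem-Kakeya applies to the upper half alone. The polynomial is that half plus, up
  to sign, its reversal, and off the circle one of the two strictly dominates the other.

  The strip is the region where the Dirichlet series of both \<open>\<zeta>(s)\<close> and
  \<open>\<zeta>(k - s)\<close> converge. The extreme points of evaluation, 2 and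
  \<open>k - 2\<close>, lie strictly inside it, so all positivity comes from convergent series;
  continuation serves only to identify the function there.

  The functional equation comes from the Mellin transform of \<open>1 / (exp x - 1)\<close> and the
  partial fractions of the cotangent. On the real axis all integrands are nonnegative, so sums and
  integrals are interchanged by monotone convergence, and the identity theorem then leaves the axis.

  Nonnegative Taylor coefficients give weak inequalities only. The leading coefficient must be
  strictly positive, which takes one argument to the right of the centre and another at the centre
  itself.\<close>

lemma enestrom_kakeya_nonzero:
  fixes g :: "nat \<Rightarrow> real" and w :: complex
  assumes mono: "\<And>i. i < N \<Longrightarrow> g i \<le> g (Suc i)" and "0 \<le> g 0" "0 < g N" and w: "1 < norm w"
  shows "(\<Sum>i\<le>N. of_real (g i) * w ^ i) \<noteq> 0"
proof
  assume zero: "(\<Sum>i\<le>N. of_real (g i) * w ^ i) = 0"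
  \<comment> \<open>Multiplication by \<open>w - 1\<close> turns the coefficients into their
    nonnegative differences. The triangle inequality then bounds everything below the leading term
    by \<open>g N * norm w ^ N\<close>, which is too small to cancel
    \<open>g N * norm w ^ Suc N\<close>.\<close>
  have telescope: "(w - 1) * (\<Sum>i\<le>n. of_real (g i) * w ^ i) =
      of_real (g n) * w ^ Suc n - of_real (g 0) - (\<Sum>i<n. of_real (g (Suc i) - g i) * w ^ Suc i)" for n
    by (induction n) (simp_all add: algebra_simps)
  from telescope[of N] zero
  have eq: "of_real (g N) * w ^ Suc N = of_real (g 0) + (\<Sum>i<N. of_real (g (Suc i) - g i) * w ^ Suc i)"
    by (simp add: algebra_simps)
  have "g N * norm w ^ Suc N = norm (of_real (g N) * w ^ Suc N)"
    using assms by (simp add: norm_mult norm_power)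
  also have "\<dots> \<le> norm (of_real (g 0) :: complex) +
                   (\<Sum>i<N. norm (of_real (g (Suc i) - g i) * w ^ Suc i))"
    unfolding eq by (intro order_trans[OF norm_triangle_ineq] add_left_mono norm_sum)
  also have "\<dots> \<le> g 0 * norm w ^ N + (\<Sum>i<N. (g (Suc i) - g i) * norm w ^ N)"
  proof (intro add_mono sum_mono)
    show "norm (of_real (g 0) :: complex) \<le> g 0 * norm w ^ N"
      using assms by (simp add: mult_left_le one_le_power mult_le_cancel_left1)
    fix i assume "i \<in> {..<N}"
    moreover have "norm w ^ Suc i \<le> norm w ^ N"
      using w calculation by (intro power_increasing) auto
    ultimately show "norm (of_real (g (Suc i) - g i) * w ^ Suc i) \<le> (g (Suc i) - g i) * norm w ^ N"
      unfolding norm_mult norm_of_real norm_power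
      using mono[of i] by (intro mult_mono) auto
  qed
  also have "\<dots> = g N * norm w ^ N"
    by (simp add: sum_distrib_right[symmetric] sum_lessThan_telescope distrib_right[symmetric])
  finally have "norm w ^ Suc N \<le> norm w ^ N"
    using \<open>0 < g N\<close> by (simp del: power_Suc)
  with w show False
    by (simp add: power_increasing_iff[OF w] del: power_Suc)
qed

text \<open>The difference of the squared norms factors as
  \<open>(1 - (norm r)^2) * (1 - (norm w)^2)\<close>. It is used with \<open>r\<close> a root, to
  compare a polynomial with its reversal one linear factor at a time.\<close>

lemma norm_one_minus_mult_le:
  fixes r w :: complex
  assumes "norm r \<le> 1" "1 \<le> norm w"
  shows "norm (1 - r * w) \<le> norm (cnj w - r)"
proof -
  have "(norm (1 - r * w))\<^sup>2 - (norm (cnj w - r))\<^sup>2 = (1 - (norm r)\<^sup>2) * (1 - (norm w)\<^sup>2)"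
    unfolding cmod_power2 by (simp add: power2_eq_square algebra_simps)
  also have "\<dots> \<le> 0"
    using assms by (intro mult_nonneg_nonpos) (auto simp: power_le_one)
  finally show ?thesis
    by (simp add: power_mono_iff)
qed

text \<open>Reversal replaces each root factor \<open>w - r\<close> by \<open>1 - r * w\<close>, and
  all roots lie in the closed unit disc. The factorwise bound ends at \<open>cnj w\<close>; because
  the coefficients are real, the norm there is the same as at \<open>w\<close>.\<close>

lemma norm_reverse_sum_le:
  fixes g :: "nat \<Rightarrow> real" and w :: complex
  assumes roots: "\<And>z :: complex. 1 < norm z \<Longrightarrow> (\<Sum>i\<le>N. of_real (g i) * z ^ i) \<noteq> 0"
    and "g N \<noteq> 0" and w: "1 \<le> norm w"
  shows "norm (w ^ N * (\<Sum>i\<le>N. of_real (g i) * inverse w ^ i)) \<le> norm (\<Sum>i\<le>N. of_real (g i) * w ^ i)"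
proof -
  define p where "p = (\<Sum>i\<le>N. monom (complex_of_real (g i)) i)"
  have poly_p: "poly p z = (\<Sum>i\<le>N. of_real (g i) * z ^ i)" for z
    by (simp add: p_def poly_sum poly_monom)
  have coeff_p: "coeff p i = (if i \<le> N then of_real (g i) else 0)" for i
    by (auto simp: p_def coeff_sum if_distrib cong: if_cong)
  have deg: "degree p = N"
    using \<open>g N \<noteq> 0\<close> by (intro antisym degree_le le_degree) (auto simp: coeff_p)
  obtain root where p: "smult (lead_coeff p) (\<Prod>i<N. [:-root i, 1:]) = p"
    using complex_poly_decompose'[of p] deg by metis
  have poly_eq: "poly p z = of_real (g N) * (\<Prod>i<N. z - root i)" for z
    by (subst p[symmetric]) (simp add: poly_prod deg coeff_p)
  have root: "norm (root i) \<le> 1" if "i < N" for i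
  proof (rule ccontr)
    assume "\<not> norm (root i) \<le> 1"
    hence "poly p (root i) \<noteq> 0"
      using roots[of "root i"] by (simp add: poly_p)
    with that show False by (auto simp: poly_eq)
  qed
  have w0: "w \<noteq> 0" using w by auto
  have "norm (w ^ N * poly p (inverse w)) = \<bar>g N\<bar> * norm (\<Prod>i<N. w * (inverse w - root i))"
    unfolding poly_eq norm_mult prod.distrib norm_of_real by simp
  also have "\<dots> = \<bar>g N\<bar> * (\<Prod>i<N. norm (1 - root i * w))"
    using w0 by (simp add: right_diff_distrib mult.commute flip: prod_norm)
  also have "\<dots> \<le> \<bar>g N\<bar> * (\<Prod>i<N. norm (cnj w - root i))"
    using w root by (intro mult_left_mono prod_mono conjI norm_one_minus_mult_le) auto
  also have "\<dots> = norm (poly p (cnj w))"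
    by (simp add: poly_eq norm_mult prod_norm)
  also have "poly p (cnj w) = cnj (poly p w)"
    by (simp add: poly_p)
  finally show ?thesis by (simp only: poly_p complex_mod_cnj)
qed

text \<open>The polynomial is \<open>w ^ N * G w\<close> plus \<open>\<epsilon>\<close> times
  \<open>w ^ N * G (inverse w)\<close>, where \<open>G\<close> carries the upper half of the
  coefficients. Outside the circle the first norm exceeds \<open>norm (G w)\<close>, which in turn
  bounds the second, so they cannot cancel. The symmetry under \<open>w \<mapsto> inverse w\<close>
  settles the inside.\<close>

lemma zeros_on_circle_if_coeffs_increase_from_middle:
  fixes a :: "nat \<Rightarrow> real" and \<epsilon> :: real and w :: complex
  assumes sym: "\<And>j. j \<le> 2 * N \<Longrightarrow> a (2 * N - j) = \<epsilon> * a j" and eps: "\<bar>\<epsilon>\<bar> = 1"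
    and mono: "\<And>i. i < N \<Longrightarrow> a (N + i) \<le> a (N + Suc i)" and "0 \<le> a N" "0 < a (2 * N)"
    and zero: "(\<Sum>j\<le>2 * N. of_real (a j) * w ^ j) = 0"
  shows "norm w = 1"
proof -
  define P where "P = (\<lambda>w. \<Sum>j\<le>2 * N. of_real (a j) * w ^ j :: complex)"
  have "N \<noteq> 0"
    using zero assms by (intro notI) auto
  \<comment> \<open>The middle coefficient is shared equally between the two halves.\<close>
  define g where "g = (\<lambda>i. if i = 0 then a N / 2 else a (N + i))"
  define G where "G = (\<lambda>w. \<Sum>i\<le>N. of_real (g i) * w ^ i :: complex)"
  have g_mono: "g i \<le> g (Suc i)" if "i < N" for i
    using mono[OF that] \<open>0 \<le> a N\<close> by (auto simp: g_def)
  have gN: "g N > 0"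
    using \<open>0 < a (2 * N)\<close> \<open>N \<noteq> 0\<close> by (simp add: g_def mult_2)
  have g0: "g 0 \<ge> 0"
    using \<open>0 \<le> a N\<close> by (simp add: g_def)
  have P_G: "P w = w ^ N * G w + of_real \<epsilon> * (w ^ N * G (inverse w))" if "w \<noteq> 0" for w
  proof -
    have aN: "a N = \<epsilon> * a N"
      using sym[of N] by (simp add: mult_2)
    have up: "w ^ N * G w = of_real (a N) / 2 * w ^ N + (\<Sum>i=1..N. of_real (a (N + i)) * w ^ (N + i))"
      unfolding G_def atMost_atLeast0 sum.atLeast_Suc_atMost[OF le0]
      by (simp add: g_def algebra_simps sum_distrib_left power_add)
    have "w ^ N * G (inverse w) = of_real (a N) / 2 * w ^ N + (\<Sum>i=1..N. of_real (a (N + i)) * w ^ (N - i))"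
      unfolding G_def atMost_atLeast0 sum.atLeast_Suc_atMost[OF le0]
      using that by (simp add: g_def algebra_simps sum_distrib_left power_diff field_simps)
    also have "of_real \<epsilon> * \<dots> = of_real (\<epsilon> * a N) / 2 * w ^ N + (\<Sum>i=1..N. of_real (\<epsilon> * a (N + i)) * w ^ (N - i))"
      by (simp add: algebra_simps sum_distrib_left)
    also have "\<epsilon> * a N = a N" using aN by simp
    also have "(\<Sum>i=1..N. of_real (\<epsilon> * a (N + i)) * w ^ (N - i)) = (\<Sum>j<N. of_real (a j) * w ^ j)"
    proof (rule sum.reindex_bij_witness[of _ "\<lambda>j. N - j" "\<lambda>i. N - i"])
      fix i assume "i \<in> {1..N}"
      thus "of_real (a (N - i)) * w ^ (N - i) = of_real (\<epsilon> * a (N + i)) * w ^ (N - i)"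
        using sym[of "N + i"] by (simp add: mult_2)
    qed auto
    finally have down: "of_real \<epsilon> * (w ^ N * G (inverse w)) =
        of_real (a N) / 2 * w ^ N + (\<Sum>j<N. of_real (a j) * w ^ j)" .
    have "{..2 * N} = {..<N} \<union> {N} \<union> {N + 1..N + N}" by auto
    hence "P w = (\<Sum>j<N. of_real (a j) * w ^ j) + of_real (a N) * w ^ N + (\<Sum>j=N + 1..N + N. of_real (a j) * w ^ j)"
      unfolding P_def by (simp add: sum.union_disjoint disjoint_iff)
    also have "(\<Sum>j=N + 1..N + N. of_real (a j) * w ^ j) = (\<Sum>i=1..N. of_real (a (N + i)) * w ^ (N + i))"
      by (rule sum.reindex_bij_witness[of _ "\<lambda>i. N + i" "\<lambda>j. j - N"]) auto
    finally show ?thesis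
      unfolding up down by (simp add: algebra_simps)
  qed
  have outside: "P w \<noteq> 0" if w: "1 < norm w" for w
  proof
    assume "P w = 0"
    have nz: "G w \<noteq> 0" if "1 < norm w" for w
      unfolding G_def using g_mono g0 gN that by (rule enestrom_kakeya_nonzero)
    have "w \<noteq> 0" using w by auto
    have "1 < norm w ^ N"
      using w \<open>N \<noteq> 0\<close> by (simp add: one_less_power)
    hence "norm (G w) < norm (w ^ N * G w)"
      using nz[OF w] by (simp add: norm_mult norm_power)
    also have "w ^ N * G w = - (of_real \<epsilon> * (w ^ N * G (inverse w)))"
      using P_G[OF \<open>w \<noteq> 0\<close>] \<open>P w = 0\<close> by (simp add: eq_neg_iff_add_eq_0)
    also have "norm \<dots> = norm (w ^ N * G (inverse w))"
      using eps by (simp add: norm_mult)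
    also have "\<dots> \<le> norm (G w)"
      unfolding G_def using nz gN w unfolding G_def by (intro norm_reverse_sum_le) auto
    finally show False by simp
  qed
  have "w \<noteq> 0"
  proof
    assume "w = 0"
    hence "a 0 = 0" using zero
      by (simp add: power_0_left if_distrib cong: if_cong)
    with sym[of 0] \<open>0 < a (2 * N)\<close> show False by simp
  qed
  have "P (inverse w) = inverse w ^ (2 * N) * of_real \<epsilon> * P w"
  proof -
    have "\<epsilon> * \<epsilon> = 1" using eps by (auto simp: abs_if split: if_splits)
    hence e2: "of_real \<epsilon> * of_real \<epsilon> = (1::complex)" by (metis of_real_mult of_real_1)
    have "inverse w ^ (2 * N) * w ^ N = inverse w ^ N"
      using \<open>w \<noteq> 0\<close> by (simp add: mult_2 power_add power_inverse)
    hence "inverse w ^ (2 * N) * of_real \<epsilon> * P w =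
      inverse w ^ N * (of_real \<epsilon> * G w + of_real \<epsilon> * of_real \<epsilon> * G (inverse w))"
      unfolding P_G[OF \<open>w \<noteq> 0\<close>] by (simp add: algebra_simps)
    thus ?thesis
      using P_G[of "inverse w"] \<open>w \<noteq> 0\<close> e2 by (simp add: algebra_simps)
  qed
  hence "P (inverse w) = 0" using zero by (simp add: P_def)
  hence "\<not> norm w < 1"
    using outside[of "inverse w"] \<open>w \<noteq> 0\<close> by (auto simp: norm_inverse one_less_inverse)
  moreover have "\<not> norm w > 1"
    using outside[of w] zero by (auto simp: P_def)
  ultimately show ?thesis by simp
qed

section \<open>The Dirichlet series of the zeta function\<close>

definition zeta_series :: "complex \<Rightarrow> complex" where
  "zeta_series s = (\<Sum>n. of_nat (Suc n) powr (-s))"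

lemma norm_of_nat_powr: "norm (of_nat (Suc n) powr s :: complex) = real (Suc n) powr Re s"
  using norm_powr_real_powr[of "of_nat (Suc n)" s] by simp

lemma summable_nat_powr: "c > 1 \<Longrightarrow> summable (\<lambda>n. real (Suc n) powr (-c))"
  by (subst summable_Suc_iff) (simp add: summable_real_powr_iff)

lemma summable_norm_zeta_series:
  "Re s > 1 \<Longrightarrow> summable (\<lambda>n. norm (of_nat (Suc n) powr (-s) :: complex))"
  using summable_nat_powr[of "Re s"] by (simp only: norm_of_nat_powr uminus_complex.sel)

lemma zeta_series_sums:
  "Re s > 1 \<Longrightarrow> (\<lambda>n. of_nat (Suc n) powr (-s)) sums zeta_series s"
  unfolding zeta_series_def
  by (rule summable_sums[OF summable_norm_cancel[OF summable_norm_zeta_series]])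

lemma uniform_limit_zeta_series:
  assumes "c > 1"
  shows "uniform_limit {s. Re s \<ge> c} (\<lambda>N s. \<Sum>n<N. of_nat (Suc n) powr (-s)) zeta_series sequentially"
proof -
  have "norm (of_nat (Suc n) powr (-s) :: complex) \<le> real (Suc n) powr (-c)"
    if "s \<in> {s. Re s \<ge> c}" for n s
    using that unfolding norm_of_nat_powr by (intro powr_mono) auto
  from Weierstrass_m_test[OF this summable_nat_powr[OF assms]] show ?thesis
    by (simp only: zeta_series_def[abs_def])
qed

lemma holomorphic_zeta_series: "zeta_series holomorphic_on {s. Re s > 1}"
proof (rule holomorphic_uniform_sequence[OF open_halfspace_Re_gt])
  show "(\<lambda>s. \<Sum>n<N. of_nat (Suc n) powr (-s)) holomorphic_on {s. Re s > 1}" for N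
    by (intro holomorphic_intros) (simp del: of_nat_Suc)
  fix s :: complex assume "s \<in> {s. Re s > 1}"
  hence s: "Re s > 1" by simp
  \<comment> \<open>Half the distance to the line \<open>Re s = 1\<close> keeps the closed ball in a
    half-plane on which the series converges uniformly.\<close>
  define d where "d = (Re s - 1) / 2"
  have sub: "cball s d \<subseteq> {z. Re z \<ge> 1 + d}"
  proof
    fix z assume "z \<in> cball s d"
    hence "norm (s - z) \<le> d" by (simp add: dist_norm)
    hence "Re (s - z) \<le> d" using complex_Re_le_cmod order_trans by blast
    thus "z \<in> {z. Re z \<ge> 1 + d}" by (simp add: d_def field_simps)
  qed
  have "d > 0" using s by (simp add: d_def)
  moreover have "cball s d \<subseteq> {s. Re s > 1}"
    using sub \<open>d > 0\<close> by fastforce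
  moreover have "uniform_limit (cball s d) (\<lambda>N s. \<Sum>n<N. of_nat (Suc n) powr (-s)) zeta_series sequentially"
    by (rule uniform_limit_on_subset[OF uniform_limit_zeta_series sub]) (use \<open>d > 0\<close> in simp)
  ultimately show "\<exists>d>0. cball s d \<subseteq> {s. Re s > 1} \<and>
      uniform_limit (cball s d) (\<lambda>N s. \<Sum>n<N. of_nat (Suc n) powr (-s)) zeta_series sequentially"
    by blast
qed

lemma holomorphic_zeta_series' [holomorphic_intros]:
  assumes "f holomorphic_on A" "\<And>z. z \<in> A \<Longrightarrow> Re (f z) > 1"
  shows "(\<lambda>z. zeta_series (f z)) holomorphic_on A"
  using holomorphic_on_compose[OF assms(1) holomorphic_on_subset[OF holomorphic_zeta_series]] assms(2)
  by (auto simp: o_def image_subset_iff)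

lemma zeta_series_of_real:
  assumes "x > 1"
  shows "zeta_series (of_real x) = of_real (\<Sum>n. real (Suc n) powr (-x))"
    and "Re (zeta_series (of_real x)) > 0"
proof -
  have eq: "of_nat (Suc n) powr (- of_real x) = complex_of_real (real (Suc n) powr (-x))" for n
    by (metis of_nat_0_le_iff of_real_minus of_real_of_nat_eq powr_of_real)
  show *: "zeta_series (of_real x) = of_real (\<Sum>n. real (Suc n) powr (-x))"
    unfolding zeta_series_def eq by (rule suminf_of_real[OF summable_nat_powr[OF assms], symmetric])
  have "(\<Sum>n. real (Suc n) powr (-x)) > 0"
    by (rule suminf_pos[OF summable_nat_powr[OF assms]]) simp
  thus "Re (zeta_series (of_real x)) > 0" by (simp add: *)
qed


section \<open>Absolutely monotone functions\<close>

text \<open>Membership in the nonnegative reals also says that the derivatives are real. As a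
  condition on Taylor coefficients at one point it passes to sums, products and derivatives;
  positivity on an interval would not survive differentiation.\<close>

definition abs_monotone_at :: "complex \<Rightarrow> real \<Rightarrow> (complex \<Rightarrow> complex) \<Rightarrow> bool" where
  "abs_monotone_at c r f \<longleftrightarrow> f holomorphic_on ball c r \<and> (\<forall>n. (deriv ^^ n) f c \<in> \<real>\<^sub>\<ge>\<^sub>0)"

lemma abs_monotone_at_add:
  assumes "abs_monotone_at c r f" "abs_monotone_at c r g" "r > 0"
  shows "abs_monotone_at c r (\<lambda>s. f s + g s)"
  using assms higher_deriv_add[of f "ball c r" g c]
  by (auto simp: abs_monotone_at_def intro!: holomorphic_intros nonneg_Reals_add_I)

lemma sum_in_nonneg_Reals:
  "(\<And>i. i \<in> A \<Longrightarrow> f i \<in> \<real>\<^sub>\<ge>\<^sub>0) \<Longrightarrow> sum f A \<in> (\<real>\<^sub>\<ge>\<^sub>0 :: complex set)"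
  by (induction A rule: infinite_finite_induct) auto

lemma abs_monotone_at_mult:
  assumes "abs_monotone_at c r f" "abs_monotone_at c r g" "r > 0"
  shows "abs_monotone_at c r (\<lambda>s. f s * g s)"
proof -
  have "(\<Sum>i = 0..n. of_nat (n choose i) * (deriv ^^ i) f c * (deriv ^^ (n - i)) g c) \<in> \<real>\<^sub>\<ge>\<^sub>0" for n
    using assms by (intro sum_in_nonneg_Reals nonneg_Reals_mult_I) (auto simp: abs_monotone_at_def)
  thus ?thesis
    using assms higher_deriv_mult[of f "ball c r" g c]
    by (auto simp: abs_monotone_at_def intro!: holomorphic_intros)
qed

lemma abs_monotone_at_deriv:
  assumes "abs_monotone_at c r f"
  shows "abs_monotone_at c r (deriv f)"
proof -
  have "(deriv ^^ n) (deriv f) = (deriv ^^ Suc n) f" for n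
    by (simp add: funpow_swap1)
  thus ?thesis
    using assms unfolding abs_monotone_at_def by (metis holomorphic_deriv open_ball)
qed

text \<open>To the right of \<open>c\<close> the function is a power series with nonnegative
  coefficients in a nonnegative variable, so both claims hold term by term.\<close>

lemma abs_monotone_at_nonneg:
  assumes "abs_monotone_at c r f" "0 \<le> x" "x < r"
  shows "f (c + of_real x) \<in> \<real>\<^sub>\<ge>\<^sub>0"
    and "x \<le> y \<Longrightarrow> y < r \<Longrightarrow> Re (f (c + of_real x)) \<le> Re (f (c + of_real y))"
proof -
  define a where "a = (\<lambda>n. Re ((deriv ^^ n) f c) / fact n)"
  have a: "a n \<ge> 0" for n
    using assms(1) by (auto simp: a_def abs_monotone_at_def complex_nonneg_Reals_iff)
  have sums: "(\<lambda>n. complex_of_real (a n * t ^ n)) sums f (c + of_real t)" if "0 \<le> t" "t < r" for t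
  proof -
    have "(\<lambda>n. (deriv ^^ n) f c / fact n * (c + of_real t - c) ^ n) sums f (c + of_real t)"
      using assms(1) that by (intro holomorphic_power_series[of f c r])
        (auto simp: abs_monotone_at_def dist_norm)
    also have "(\<lambda>n. (deriv ^^ n) f c / fact n * (c + of_real t - c) ^ n) = (\<lambda>n. of_real (a n * t ^ n))"
    proof
      fix n
      have "(deriv ^^ n) f c = of_real (Re ((deriv ^^ n) f c))"
        using assms(1) by (auto simp: abs_monotone_at_def complex_nonneg_Reals_iff complex_eq_iff)
      thus "(deriv ^^ n) f c / fact n * (c + of_real t - c) ^ n = of_real (a n * t ^ n)"
        by (simp add: a_def)
    qed
    finally show ?thesis .
  qed
  have Re_sums: "(\<lambda>n. a n * t ^ n) sums Re (f (c + of_real t))" "Im (f (c + of_real t)) = 0"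
    if "0 \<le> t" "t < r" for t
    using sums_Re[OF sums[OF that]] sums_Im[OF sums[OF that]] by (simp_all add: sums_iff)
  show "f (c + of_real x) \<in> \<real>\<^sub>\<ge>\<^sub>0"
  proof -
    have "0 \<le> Re (f (c + of_real x))"
      by (rule sums_le[OF _ sums_zero Re_sums(1)[OF assms(2,3)]]) (simp add: a assms(2))
    thus ?thesis by (simp only: complex_nonneg_Reals_iff Re_sums(2)[OF assms(2,3)])
  qed
  show "Re (f (c + of_real x)) \<le> Re (f (c + of_real y))" if "x \<le> y" "y < r"
  proof -
    have "a n * x ^ n \<le> a n * y ^ n" for n
      using a assms(2) that(1) by (intro mult_left_mono power_mono) auto
    thus ?thesis
      by (rule sums_le[OF _ Re_sums(1)[OF assms(2,3)] Re_sums(1)[OF order.trans[OF assms(2) that(1)] that(2)]])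
  qed
qed

lemma tendsto_nonneg_Reals:
  assumes "(f \<longlongrightarrow> l) F" "F \<noteq> bot" "eventually (\<lambda>x. f x \<in> (\<real>\<^sub>\<ge>\<^sub>0 :: complex set)) F"
  shows "l \<in> \<real>\<^sub>\<ge>\<^sub>0"
  using closed_nonneg_Reals_complex assms by (metis Lim_in_closed_set)

lemma higher_deriv_sum_exp:
  fixes u v :: "'i \<Rightarrow> complex"
  assumes "finite I"
  shows "(deriv ^^ n) (\<lambda>s. \<Sum>i\<in>I. exp (u i * s + v i)) = (\<lambda>s. \<Sum>i\<in>I. u i ^ n * exp (u i * s + v i))"
proof (induction n)
  case (Suc n)
  have "deriv (\<lambda>s. \<Sum>i\<in>I. u i ^ n * exp (u i * s + v i)) s = (\<Sum>i\<in>I. u i ^ Suc n * exp (u i * s + v i))" for s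
    by (rule DERIV_imp_deriv) (auto intro!: derivative_eq_intros sum.cong)
  thus ?case
    by (simp only: funpow.simps o_apply Suc.IH)
qed auto

text \<open>A term of the double series is an exponential in \<open>s\<close> with rate
  \<open>ln b - ln a\<close>. At the centre its n-th derivative is \<open>(ln b - ln a) ^ n\<close>
  times a weight symmetric in \<open>a\<close> and \<open>b\<close>: nonnegative for even
  \<open>n\<close>, while for odd \<open>n\<close> swapping \<open>a\<close> and \<open>b\<close>
  shows that the total vanishes. Uniform convergence transfers this from partial sums to the
  series.\<close>

lemma abs_monotone_at_zeta_series_product:
  fixes k :: real
  assumes "k > 2"
  shows "abs_monotone_at (of_real (k / 2)) (k / 2 - 1) (\<lambda>s. zeta_series s * zeta_series (of_real k - s))"
proof -
  define c where "c = complex_of_real (k / 2)"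
  define r where "r = k / 2 - 1"
  define Z where "Z = (\<lambda>N s. \<Sum>n<N. of_nat (Suc n) powr (-s) :: complex)"
  let ?h = "\<lambda>s. zeta_series s * zeta_series (of_real k - s)"
  let ?h' = "\<lambda>N s. Z N s * Z N (of_real k - s)"
  have Re_bound: "Re s > k / 2 - d \<and> Re (of_real k - s) > k / 2 - d" if "s \<in> ball c d" for s d
    using that abs_Re_le_cmod[of "c - s"] by (auto simp: c_def dist_norm)
  have Re_bound': "Re s \<ge> k / 2 - d \<and> Re (of_real k - s) \<ge> k / 2 - d" if "s \<in> cball c d" for s d
    using that abs_Re_le_cmod[of "c - s"] by (auto simp: c_def dist_norm)
  have hol: "?h holomorphic_on ball c r"
    by (intro holomorphic_intros) (use Re_bound[of _ r] in \<open>auto simp: r_def\<close>)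
  have hol': "?h' N holomorphic_on A" for N A
    unfolding Z_def by (intro holomorphic_intros) (simp_all del: of_nat_Suc)
  \<comment> \<open>On the closed ball of half the radius both arguments keep real part at least
    \<open>1 + r / 2\<close>, where the convergence is uniform. Derivatives at the centre require no
    larger neighbourhood.\<close>
  have "r / 2 > 0" using assms by (simp add: r_def)
  have r2: "k / 2 - r / 2 = 1 + r / 2" by (simp add: r_def field_simps)
  have sub: "cball c (r / 2) \<subseteq> {s. Re s \<ge> 1 + r / 2}"
    using Re_bound'[of _ "r / 2"] unfolding r2 by blast
  have sub': "(\<lambda>s. of_real k - s) ` cball c (r / 2) \<subseteq> {s. Re s \<ge> 1 + r / 2}"
    using Re_bound'[of _ "r / 2"] unfolding r2 by blast
  have lim1: "uniform_limit (cball c (r / 2)) Z zeta_series sequentially"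
    unfolding Z_def by (rule uniform_limit_on_subset[OF uniform_limit_zeta_series sub])
      (use \<open>r / 2 > 0\<close> in simp)
  have lim2: "uniform_limit (cball c (r / 2)) (\<lambda>N s. Z N (of_real k - s)) (\<lambda>s. zeta_series (of_real k - s)) sequentially"
    unfolding Z_def
  proof (rule uniform_limit_compose'[OF uniform_limit_zeta_series])
    show "(\<lambda>s. of_real k - s) \<in> cball c (r / 2) \<rightarrow> {s. Re s \<ge> 1 + r / 2}"
      using sub' by (simp only: image_subset_iff_funcset)
  qed (use \<open>r / 2 > 0\<close> in simp)
  have "Re s > 1" if "s \<in> cball c (r / 2)" for s
    using subsetD[OF sub that] \<open>r / 2 > 0\<close> by simp
  moreover have "Re (of_real k - s) > 1" if "s \<in> cball c (r / 2)" for s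
    using subsetD[OF sub' imageI[OF that]] \<open>r / 2 > 0\<close> by simp
  ultimately have bdd: "bounded (zeta_series ` cball c (r / 2))"
      "bounded ((\<lambda>s. zeta_series (of_real k - s)) ` cball c (r / 2))"
    by (auto intro!: compact_imp_bounded compact_continuous_image holomorphic_on_imp_continuous_on holomorphic_intros)
  have lim: "uniform_limit (ball c (r / 2)) ?h' ?h sequentially"
    by (rule uniform_limit_on_subset[OF uniform_lim_mult[OF lim1 lim2 bdd]]) auto
  have "(deriv ^^ n) (?h' N) c \<in> \<real>\<^sub>\<ge>\<^sub>0" for n N
  proof -
    define l where "l = (\<lambda>n. ln (real (Suc n)))"
    define I where "I = {..<N} \<times> {..<N}"
    define e where "e = (\<lambda>(a, b). exp (- (k / 2) * (l a + l b)))"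
    have powr: "of_nat (Suc n) powr s = exp (s * of_real (l n))" for n and s :: complex
      unfolding powr_def l_def by (simp add: Ln_of_nat del: of_nat_Suc)
    have "?h' N = (\<lambda>s. \<Sum>(a, b)\<in>I. exp ((of_real (l b) - of_real (l a)) * s + (- of_real k * of_real (l b))))"
      unfolding Z_def powr I_def
      by (simp add: sum_product sum.cartesian_product exp_add[symmetric] algebra_simps)
    hence "(deriv ^^ n) (?h' N) c =
        (\<Sum>(a, b)\<in>I. (of_real (l b) - of_real (l a)) ^ n * exp ((of_real (l b) - of_real (l a)) * c + (- of_real k * of_real (l b))))"
      using higher_deriv_sum_exp[of I n "\<lambda>(a, b). of_real (l b) - of_real (l a)" "\<lambda>(a, b). - of_real k * of_real (l b)"]
      by (simp add: I_def case_prod_unfold fun_eq_iff)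
    also have "\<dots> = of_real (\<Sum>(a, b)\<in>I. (l b - l a) ^ n * e (a, b))"
    proof -
      have "(of_real (l b) - of_real (l a)) * c + (- of_real k * of_real (l b)) =
          complex_of_real (- (k / 2) * (l a + l b))" for a b
        by (simp add: c_def field_simps)
      thus ?thesis by (simp only: e_def exp_of_real[symmetric] case_prod_unfold prod.sel of_real_sum of_real_mult of_real_diff of_real_power)
    qed
    finally have eq: "(deriv ^^ n) (?h' N) c = of_real (\<Sum>(a, b)\<in>I. (l b - l a) ^ n * e (a, b))" .
    have "(\<Sum>(a, b)\<in>I. (l b - l a) ^ n * e (a, b)) \<ge> 0"
    proof (cases "even n")
      case True
      thus ?thesis by (intro sum_nonneg) (auto simp: e_def)
    next
      case False
      have "(\<Sum>(a, b)\<in>I. (l b - l a) ^ n * e (a, b)) = (\<Sum>(a, b)\<in>I. (l a - l b) ^ n * e (b, a))"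
        by (rule sum.reindex_bij_witness[of _ prod.swap prod.swap]) (auto simp: I_def)
      also have "\<dots> = - (\<Sum>(a, b)\<in>I. (l b - l a) ^ n * e (a, b))"
      proof -
        have *: "(l a - l b) ^ n * e (b, a) = - ((l b - l a) ^ n * e (a, b))" for a b
          using power_minus_odd[OF False, of "l b - l a"] by (simp add: e_def add.commute)
        show ?thesis
          unfolding sum_negf[symmetric]
        proof (rule sum.cong)
          fix x assume "x \<in> I"
          show "(case x of (a, b) \<Rightarrow> (l a - l b) ^ n * e (b, a)) = - (case x of (a, b) \<Rightarrow> (l b - l a) ^ n * e (a, b))"
            unfolding case_prod_unfold by (rule *)
        qed simp
      qed
      finally show ?thesis by simp
    qed
    thus ?thesis unfolding eq using nonneg_Reals_of_real_iff by blast
  qed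
  hence nonneg: "eventually (\<lambda>N. (deriv ^^ n) (?h' N) c \<in> \<real>\<^sub>\<ge>\<^sub>0) sequentially" for n
    by (rule always_eventually[OF allI])
  have "c \<in> ball c (r / 2)" using \<open>r / 2 > 0\<close> by simp
  hence "(deriv ^^ n) ?h c \<in> \<real>\<^sub>\<ge>\<^sub>0" for n
    by (rule tendsto_nonneg_Reals[OF higher_deriv_complex_uniform_limit[OF lim
          always_eventually[OF allI[OF hol']] sequentially_bot open_ball] sequentially_bot nonneg])
  hence "abs_monotone_at c r ?h"
    unfolding abs_monotone_at_def using hol by (intro conjI allI)
  thus ?thesis by (simp only: c_def r_def)
qed

text \<open>Reflection about the centre cancels the derivatives of even order and doubles those of
  odd order to \<open>2 * Polygamma n (k / 2)\<close>, which is positive.\<close>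

lemma abs_monotone_at_Digamma_difference:
  fixes k :: real
  assumes "k > 0"
  shows "abs_monotone_at (of_real (k / 2)) (k / 2) (\<lambda>s. Digamma s - Digamma (of_real k - s))"
proof -
  define c where "c = complex_of_real (k / 2)"
  have Re_bound: "Re s > 0 \<and> Re (of_real k - s) > 0" if "s \<in> ball c (k / 2)" for s
    using that abs_Re_le_cmod[of "c - s"] by (auto simp: c_def dist_norm)
  have not_int: "s \<notin> \<int>\<^sub>\<le>\<^sub>0" "of_real k - s \<notin> \<int>\<^sub>\<le>\<^sub>0" if "s \<in> ball c (k / 2)" for s
    using Re_bound[OF that] by (force elim!: nonpos_Ints_cases)+
  have c: "c \<in> ball c (k / 2)" using assms by simp
  have hol: "Digamma holomorphic_on {s. Re s > 0}"
    by (intro holomorphic_on_Polygamma) (auto elim!: nonpos_Ints_cases)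
  have hol1: "Digamma holomorphic_on ball c (k / 2)"
    by (rule holomorphic_on_subset[OF hol]) (use Re_bound in auto)
  have hol2: "(\<lambda>s. Digamma (of_real k - s)) holomorphic_on ball c (k / 2)"
    by (rule holomorphic_on_compose[of "\<lambda>s. of_real k - s" _ Digamma, unfolded o_def])
       (use Re_bound in \<open>auto intro!: holomorphic_intros holomorphic_on_subset[OF hol]\<close>)
  have "(deriv ^^ n) (\<lambda>s. Digamma s - Digamma (of_real k - s)) c \<in> \<real>\<^sub>\<ge>\<^sub>0" for n
  proof -
    have "(deriv ^^ n) (\<lambda>s. Digamma (of_real k - s)) c = (-1) ^ n * (deriv ^^ n) Digamma (of_real k - c)"
      using higher_deriv_compose_linear'[OF hol _ open_halfspace_Re_gt c, of "-1" "of_real k" n] Re_bound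
      by auto
    also have "of_real k - c = c" by (simp add: c_def)
    finally have "(deriv ^^ n) (\<lambda>s. Digamma s - Digamma (of_real k - s)) c = (1 - (-1) ^ n) * Polygamma n c"
      using higher_deriv_diff[OF hol1 hol2 _ c, of n] higher_deriv_Polygamma[OF not_int(1)[OF c], of n 0]
      by (simp only: open_ball left_diff_distrib mult_1 add_0)
    moreover have "k / 2 \<notin> \<int>\<^sub>\<le>\<^sub>0" using assms by (auto elim!: nonpos_Ints_cases)
    hence "odd n \<Longrightarrow> Polygamma n (k / 2) > 0" by (rule Polygamma_real_odd_pos)
    moreover have "Polygamma n c = of_real (Polygamma n (k / 2))"
      unfolding c_def by (rule Polygamma_of_real) (use assms in simp)
    ultimately show ?thesis by (cases "even n") (auto simp: complex_nonneg_Reals_iff)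
  qed
  thus ?thesis
    using hol1 hol2 by (auto simp: abs_monotone_at_def c_def intro!: holomorphic_intros)
qed

section \<open>Derivatives of a product relative to one of its factors\<close>

primrec twisted_deriv :: "(complex \<Rightarrow> complex) \<Rightarrow> (complex \<Rightarrow> complex) \<Rightarrow> nat \<Rightarrow> complex \<Rightarrow> complex" where
  "twisted_deriv L h 0 = h"
| "twisted_deriv L h (Suc m) = (\<lambda>s. deriv (twisted_deriv L h m) s + L s * twisted_deriv L h m s)"

lemma holomorphic_twisted_deriv:
  assumes "L holomorphic_on S" "h holomorphic_on S" "open S"
  shows "twisted_deriv L h m holomorphic_on S"
  using assms by (induction m) (auto intro!: holomorphic_intros)

text \<open>If \<open>p' = L p\<close> then \<open>(p F)' = p (F' + L F)\<close>: conjugated by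
  \<open>p\<close>, differentiation involves \<open>p\<close> only through its logarithmic
  derivative.\<close>

lemma higher_deriv_mult_eq_twisted_deriv:
  assumes "L holomorphic_on S" "h holomorphic_on S" "open S" "s \<in> S"
    and p: "\<And>s. s \<in> S \<Longrightarrow> (p has_field_derivative L s * p s) (at s)"
  shows "(deriv ^^ m) (\<lambda>s. p s * h s) s = p s * twisted_deriv L h m s"
  using \<open>s \<in> S\<close>
proof (induction m arbitrary: s)
  case (Suc m)
  have "(twisted_deriv L h m has_field_derivative deriv (twisted_deriv L h m) s) (at s)"
    using holomorphic_twisted_deriv[OF assms(1-3)] \<open>open S\<close> Suc.prems by (rule holomorphic_derivI)
  from DERIV_mult[OF p[OF Suc.prems] this]
  have "((\<lambda>s. p s * twisted_deriv L h m s) has_field_derivative p s * twisted_deriv L h (Suc m) s) (at s)"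
    by (simp add: algebra_simps)
  hence "((deriv ^^ m) (\<lambda>s. p s * h s) has_field_derivative p s * twisted_deriv L h (Suc m) s) (at s)"
    by (rule has_field_derivative_transform_within_open[OF _ \<open>open S\<close> Suc.prems]) (simp add: Suc.IH)
  thus ?case by (simp add: DERIV_imp_deriv)
qed simp

text \<open>Differentiation along \<open>s \<mapsto> k - s\<close> changes the sign, and so does the
  odd factor \<open>L\<close>; both summands of the recursion therefore flip together.\<close>

lemma twisted_deriv_reflect:
  assumes "L holomorphic_on S" "h holomorphic_on S" "open S" "s \<in> S"
    and S: "\<And>s. s \<in> S \<Longrightarrow> k - s \<in> S"
    and L: "\<And>s. s \<in> S \<Longrightarrow> L (k - s) = - L s" and h: "\<And>s. s \<in> S \<Longrightarrow> h (k - s) = h s"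
  shows "twisted_deriv L h m (k - s) = (-1) ^ m * twisted_deriv L h m s"
  using \<open>s \<in> S\<close>
proof (induction m arbitrary: s)
  case (Suc m)
  let ?T = "twisted_deriv L h m"
  have der: "(?T has_field_derivative deriv ?T s) (at s)" if "s \<in> S" for s
    using holomorphic_twisted_deriv[OF assms(1-3)] \<open>open S\<close> that by (rule holomorphic_derivI)
  have "((\<lambda>s. ?T (k - s)) has_field_derivative deriv ?T (k - s) * (0 - 1)) (at s)"
    by (rule DERIV_chain2[of ?T]) (auto intro!: derivative_eq_intros der S Suc.prems)
  hence "((\<lambda>s. (-1) ^ m * ?T s) has_field_derivative - deriv ?T (k - s)) (at s)"
    unfolding diff_0 mult_minus1_right
    by (rule has_field_derivative_transform_within_open[OF _ \<open>open S\<close> Suc.prems]) (rule Suc.IH)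
  moreover have "((\<lambda>s. (-1) ^ m * ?T s) has_field_derivative (-1) ^ m * deriv ?T s) (at s)"
    by (intro DERIV_cmult der Suc.prems)
  ultimately have "- deriv ?T (k - s) = (-1) ^ m * deriv ?T s"
    by (rule DERIV_unique)
  hence "deriv ?T (k - s) = - ((-1) ^ m * deriv ?T s)"
    by (metis minus_minus)
  thus ?case
    using L[OF Suc.prems] Suc.IH[OF Suc.prems] by (simp add: algebra_simps)
qed (use h in simp)

lemma abs_monotone_at_twisted_deriv:
  assumes "abs_monotone_at c r L" "abs_monotone_at c r h" "r > 0"
  shows "abs_monotone_at c r (twisted_deriv L h m)"
proof (induction m)
  case (Suc m)
  show ?case
    unfolding twisted_deriv.simps
    by (intro abs_monotone_at_add abs_monotone_at_mult abs_monotone_at_deriv Suc.IH assms)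
qed (simp add: assms)

text \<open>Strictness is carried by the summand \<open>L F\<close>, since the derivative is only
  known to be nonnegative. In the application \<open>L\<close> vanishes at the centre, hence the
  restriction to \<open>x > 0\<close>.\<close>

lemma twisted_deriv_pos:
  assumes L: "abs_monotone_at c r L" and h: "abs_monotone_at c r h" and "0 < x" "x < r"
    and pos: "Re (L (c + of_real x)) > 0" "Re (h (c + of_real x)) > 0"
  shows "Re (twisted_deriv L h m (c + of_real x)) > 0"
proof (induction m)
  case (Suc m)
  have T: "abs_monotone_at c r (twisted_deriv L h m)"
    using L h order.strict_trans[OF \<open>0 < x\<close> \<open>x < r\<close>] by (rule abs_monotone_at_twisted_deriv)
  have "Re (deriv (twisted_deriv L h m) (c + of_real x)) \<ge> 0" and Im: "Im (L (c + of_real x)) = 0"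
    using abs_monotone_at_nonneg(1)[OF abs_monotone_at_deriv[OF T], of x]
      abs_monotone_at_nonneg(1)[OF L, of x] \<open>0 < x\<close> \<open>x < r\<close>
    by (auto simp: complex_nonneg_Reals_iff)
  moreover have "Re (L (c + of_real x) * twisted_deriv L h m (c + of_real x)) > 0"
    using mult_pos_pos[OF pos(1) Suc.IH] by (simp only: times_complex.sel Im mult_zero_left diff_zero)
  ultimately show ?case
    unfolding twisted_deriv.simps plus_complex.sel by linarith
qed (use pos in simp)

text \<open>Made for a centre where \<open>L\<close> vanishes and one step of the recursion gives
  nothing strict. Two steps produce the summand \<open>deriv L c * F c\<close>, which is strictly
  positive.\<close>

lemma twisted_deriv_even_pos:
  assumes L: "abs_monotone_at c r L" and h: "abs_monotone_at c r h" and "r > 0"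
    and pos: "Re (deriv L c) > 0" "Re (h c) > 0" and "even m"
  shows "Re (twisted_deriv L h m c) > 0"
proof -
  have "Re (twisted_deriv L h (2 * n) c) > 0" for n
  proof (induction n)
    case (Suc n)
    let ?T = "twisted_deriv L h (2 * n)" and ?U = "twisted_deriv L h (Suc (2 * n))"
    have T: "abs_monotone_at c r (twisted_deriv L h i)" for i
      using L h \<open>r > 0\<close> by (rule abs_monotone_at_twisted_deriv)
    have at_c: "f c \<in> \<real>\<^sub>\<ge>\<^sub>0" if "abs_monotone_at c r f" for f
      using abs_monotone_at_nonneg(1)[OF that, of 0] \<open>r > 0\<close> by simp
    have der: "(f has_field_derivative deriv f c) (at c)" if "abs_monotone_at c r f" for f
      using that \<open>r > 0\<close> unfolding abs_monotone_at_def
      by (intro holomorphic_derivI[of _ "ball c r"]) simp_all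
    have "(?U has_field_derivative deriv (deriv ?T) c + (deriv L c * ?T c + deriv ?T c * L c)) (at c)"
      unfolding twisted_deriv.simps(2)
      by (intro DERIV_add DERIV_mult der abs_monotone_at_deriv T L)
    hence "deriv ?U c = deriv (deriv ?T) c + (deriv L c * ?T c + deriv ?T c * L c)"
      by (rule DERIV_imp_deriv)
    hence eq: "twisted_deriv L h (Suc (Suc (2 * n))) c =
        deriv (deriv ?T) c + (deriv L c * ?T c + deriv ?T c * L c) + L c * ?U c"
      unfolding twisted_deriv.simps(2)[of L h "Suc (2 * n)"] by (rule arg_cong)
    have "deriv (deriv ?T) c \<in> \<real>\<^sub>\<ge>\<^sub>0" "deriv ?T c * L c \<in> \<real>\<^sub>\<ge>\<^sub>0" "L c * ?U c \<in> \<real>\<^sub>\<ge>\<^sub>0"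
      by (intro nonneg_Reals_mult_I at_c abs_monotone_at_deriv T L)+
    hence "Re (deriv (deriv ?T) c) \<ge> 0" "Re (deriv ?T c * L c) \<ge> 0" "Re (L c * ?U c) \<ge> 0"
      unfolding complex_nonneg_Reals_iff by blast+
    moreover have Im: "Im (deriv L c) = 0"
      using at_c[OF abs_monotone_at_deriv[OF L]] unfolding complex_nonneg_Reals_iff by blast
    have "Re (deriv L c * ?T c) > 0"
      using mult_pos_pos[OF pos(1) Suc.IH] by (simp only: times_complex.sel Im mult_zero_left diff_zero)
    ultimately have "Re (twisted_deriv L h (Suc (Suc (2 * n))) c) > 0"
      unfolding eq plus_complex.sel by linarith
    thus ?case by (simp only: mult_Suc_right numeral_2_eq_2 add_Suc add_0 One_nat_def)
  qed (use pos in simp)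
  thus ?thesis using \<open>even m\<close> by (auto elim!: evenE)
qed

section \<open>The functional equation of the zeta function\<close>

text \<open>The exponential is expanded about \<open>s\<close> and integrated term by term. At
  distance \<open>\<rho>\<close> the absolute series sums to \<open>\<bar>g\<bar> * exp (Re s * l) *
  exp (\<rho> * \<bar>l\<bar>)\<close>, which is at most the sum of the absolute integrands at the
  real parameters \<open>Re s + \<rho>\<close> and \<open>Re s - \<rho>\<close>. Integrability at
  real parameters thus suffices.\<close>

lemma holomorphic_integral_exp:
  fixes M :: "'a measure" and g l :: "'a \<Rightarrow> real"
  assumes meas [measurable]: "g \<in> borel_measurable M" "l \<in> borel_measurable M"
    and "open U" and int: "\<And>\<sigma>. \<sigma> \<in> U \<Longrightarrow> integrable M (\<lambda>x. g x * exp (\<sigma> * l x))"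
  shows "(\<lambda>s. \<integral>x. of_real (g x) * exp (s * of_real (l x)) \<partial>M) holomorphic_on {s. Re s \<in> U}"
proof -
  define F where "F = (\<lambda>s :: complex. \<integral>x. of_real (g x) * exp (s * of_real (l x)) \<partial>M)"
  have "\<exists>r>0. F holomorphic_on ball s r" if s: "Re s \<in> U" for s
  proof -
    obtain r where r: "r > 0" "cball (Re s) r \<subseteq> U"
      using \<open>open U\<close> s open_contains_cball by blast
    define c where "c = (\<lambda>n. \<integral>x. of_real (g x) * exp (s * of_real (l x)) * of_real (l x) ^ n / fact n \<partial>M)"
    have "(\<lambda>n. c n * (w - s) ^ n) sums F w" if w: "w \<in> ball s r" for w
    proof -
      define \<rho> where "\<rho> = norm (w - s)"
      have \<rho>: "\<rho> \<ge> 0" "\<rho> < r"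
        using w by (auto simp: \<rho>_def dist_norm norm_minus_commute)
      define f where "f = (\<lambda>n x. of_real (g x) * exp (s * of_real (l x)) * of_real (l x) ^ n / fact n * (w - s) ^ n)"
      define B where "B = (\<lambda>x. \<bar>g x\<bar> * (exp ((Re s + \<rho>) * l x) + exp ((Re s - \<rho>) * l x)))"
      have "Re s + \<rho> \<in> U" "Re s - \<rho> \<in> U"
        using r \<rho> by (auto simp: subset_iff dist_real_def)
      hence "integrable M (\<lambda>x. \<bar>g x * exp ((Re s + \<rho>) * l x)\<bar> + \<bar>g x * exp ((Re s - \<rho>) * l x)\<bar>)"
        by (intro Bochner_Integration.integrable_add Bochner_Integration.integrable_abs int)
      hence int_B: "integrable M B"
        by (simp add: B_def abs_mult algebra_simps)
      have f_sums: "(\<lambda>n. norm (f n x)) sums (\<bar>g x\<bar> * exp (Re s * l x) * exp (\<rho> * \<bar>l x\<bar>))" for x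
      proof -
        have "norm (f n x) = \<bar>g x\<bar> * exp (Re s * l x) * ((\<rho> * \<bar>l x\<bar>) ^ n /\<^sub>R fact n)" for n
          by (simp add: f_def \<rho>_def norm_mult norm_divide norm_power power_mult_distrib field_simps)
        thus ?thesis
          using sums_mult[OF exp_converges[of "\<rho> * \<bar>l x\<bar>"], of "\<bar>g x\<bar> * exp (Re s * l x)"] by simp
      qed
      have le_B: "\<bar>g x\<bar> * exp (Re s * l x) * exp (\<rho> * \<bar>l x\<bar>) \<le> B x" for x
      proof -
        have "exp (Re s * l x) * exp (\<rho> * \<bar>l x\<bar>) \<le> exp ((Re s + \<rho>) * l x) + exp ((Re s - \<rho>) * l x)"
          by (cases "l x \<ge> 0") (auto simp: exp_add[symmetric] algebra_simps)
        thus ?thesis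
          unfolding B_def mult.assoc by (intro mult_left_mono) auto
      qed
      have partial: "(\<Sum>n<N. norm (f n x)) \<le> B x" for N x
        using sum_le_suminf[OF sums_summable[OF f_sums[of x]], of "{..<N}"] f_sums[of x] le_B[of x]
        by (simp add: sums_iff)
      have f_meas [measurable]: "f n \<in> borel_measurable M" for n
        unfolding f_def by measurable
      have f_int: "integrable M (f n)" for n
      proof (rule Bochner_Integration.integrable_bound[OF int_B])
        have "norm (f n x) \<le> norm (B x)" for x
          using member_le_sum[of n "{..<Suc n}" "\<lambda>n. norm (f n x)"] partial[where N = "Suc n" and x = x] by simp
        thus "AE x in M. norm (f n x) \<le> norm (B x)" by simp
      qed measurable
      have "summable (\<lambda>n. \<integral>x. norm (f n x) \<partial>M)"
      proof (rule summableI_nonneg_bounded)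
        fix N
        have "(\<Sum>n<N. \<integral>x. norm (f n x) \<partial>M) = (\<integral>x. (\<Sum>n<N. norm (f n x)) \<partial>M)"
          by (rule Bochner_Integration.integral_sum[symmetric]) (intro integrable_norm f_int)
        also have "\<dots> \<le> integral\<^sup>L M B"
          by (intro Bochner_Integration.integral_mono int_B partial Bochner_Integration.integrable_sum integrable_norm f_int)
        finally show "(\<Sum>n<N. \<integral>x. norm (f n x) \<partial>M) \<le> integral\<^sup>L M B" .
      qed simp
      hence "(\<lambda>n. integral\<^sup>L M (f n)) sums (\<integral>x. (\<Sum>n. f n x) \<partial>M)"
        using f_sums by (intro sums_integral f_int AE_I2) (auto simp: sums_iff)
      also have "(\<lambda>x. \<Sum>n. f n x) = (\<lambda>x. of_real (g x) * exp (w * of_real (l x)))"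
      proof
        fix x
        have "f n x = of_real (g x) * exp (s * of_real (l x)) * (((w - s) * of_real (l x)) ^ n /\<^sub>R fact n)" for n
          by (simp add: f_def power_mult_distrib scaleR_conv_of_real divide_inverse mult_ac)
        hence "(\<lambda>n. f n x) sums (of_real (g x) * exp (s * of_real (l x)) * exp ((w - s) * of_real (l x)))"
          using sums_mult[OF exp_converges[of "(w - s) * of_real (l x)"], of "of_real (g x) * exp (s * of_real (l x))"]
          by simp
        also have "of_real (g x) * exp (s * of_real (l x)) * exp ((w - s) * of_real (l x)) =
            of_real (g x) * exp (w * of_real (l x))"
          by (simp add: exp_add[symmetric] algebra_simps)
        finally show "(\<Sum>n. f n x) = of_real (g x) * exp (w * of_real (l x))"
          by (simp add: sums_iff)
      qed
      also have "(\<lambda>n. integral\<^sup>L M (f n)) = (\<lambda>n. c n * (w - s) ^ n)"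
        by (simp add: f_def c_def)
      finally show ?thesis by (simp add: F_def)
    qed
    hence "F holomorphic_on ball s r" by (rule power_series_holomorphic)
    with r show ?thesis by blast
  qed
  hence "F field_differentiable (at s within {s. Re s \<in> U})" if "Re s \<in> U" for s
    using that by (meson centre_in_ball field_differentiable_at_within holomorphic_on_imp_differentiable_at open_ball)
  thus ?thesis
    unfolding F_def[symmetric] holomorphic_on_def by simp
qed

section \<open>Partial fractions of the cotangent\<close>

lemma Digamma_reflection:
  fixes z :: complex
  assumes "z \<notin> \<int>"
  shows "Digamma z - Digamma (1 - z) = - of_real pi * cot (of_real pi * z)"
proof -
  have z: "z \<notin> \<int>\<^sub>\<le>\<^sub>0" "1 - z \<notin> \<int>\<^sub>\<le>\<^sub>0"
    using assms nonpos_Ints_subset_Ints by (auto dest!: nonpos_Ints_Int)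
  have s: "sin (of_real pi * z) \<noteq> 0"
    using assms by (auto simp: sin_eq_0 mult.commute)
  have "((\<lambda>z. Gamma z * Gamma (1 - z)) has_field_derivative
      Gamma z * Gamma (1 - z) * (Digamma z - Digamma (1 - z))) (at z)"
    using z by (auto intro!: derivative_eq_intros simp: algebra_simps)
  also have "(\<lambda>z. Gamma z * Gamma (1 - z)) = (\<lambda>z. of_real pi / sin (of_real pi * z) :: complex)"
    by (simp add: Gamma_reflection_complex fun_eq_iff)
  finally have "((\<lambda>z. of_real pi / sin (of_real pi * z)) has_field_derivative
      of_real pi / sin (of_real pi * z) * (Digamma z - Digamma (1 - z))) (at z)"
    by (simp add: Gamma_reflection_complex)
  moreover have "((\<lambda>z. of_real pi / sin (of_real pi * z)) has_field_derivative
      of_real pi / sin (of_real pi * z) * (- of_real pi * cot (of_real pi * z))) (at z)"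
    using s by (auto intro!: derivative_eq_intros simp: cot_def field_simps)
  ultimately have "of_real pi / sin (of_real pi * z) * (Digamma z - Digamma (1 - z)) =
      of_real pi / sin (of_real pi * z) * (- of_real pi * cot (of_real pi * z))"
    by (rule DERIV_unique)
  thus ?thesis
    using s by (subst (asm) mult_cancel_left) auto
qed

text \<open>The series for \<open>Digamma (1 + z)\<close> and \<open>Digamma (1 - z)\<close>
  subtract to the partial fractions, while reflection evaluates the same difference;
  \<open>1 / z\<close> comes from the shift between \<open>Digamma z\<close> and
  \<open>Digamma (1 + z)\<close>.\<close>

lemma cot_partial_fractions:
  fixes z :: complex
  assumes "z \<notin> \<int>"
  shows "(\<lambda>n. 2 * z / (of_nat (Suc n) ^ 2 - z ^ 2)) sums (1 / z - of_real pi * cot (of_real pi * z))"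
proof -
  have z0: "z \<noteq> 0" "1 + z \<noteq> 0" "1 - z \<noteq> 0"
    using assms by (auto simp: add_eq_0_iff)
  have nz: "of_nat (Suc n) - z \<noteq> 0" "of_nat (Suc n) + z \<noteq> 0" for n
    using assms by (auto simp: add_eq_0_iff simp del: of_nat_Suc)
  have "(\<lambda>n. (inverse (of_nat (Suc n)) - inverse (1 + z + of_nat n)) -
      (inverse (of_nat (Suc n)) - inverse (1 - z + of_nat n))) sums (Digamma (1 + z) - Digamma (1 - z))"
    using sums_diff[OF summable_sums[OF summable_Digamma[OF z0(2)]] summable_sums[OF summable_Digamma[OF z0(3)]]]
    by (simp add: Digamma_def)
  also have "(\<lambda>n. (inverse (of_nat (Suc n)) - inverse (1 + z + of_nat n)) -
      (inverse (of_nat (Suc n)) - inverse (1 - z + of_nat n))) = (\<lambda>n. 2 * z / (of_nat (Suc n) ^ 2 - z ^ 2))"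
  proof
    fix n
    have eq: "1 - z + of_nat n = of_nat (Suc n) - z" "1 + z + of_nat n = of_nat (Suc n) + z"
      by simp_all
    have "of_nat (Suc n) ^ 2 - z ^ 2 = (of_nat (Suc n) - z) * (of_nat (Suc n) + z)"
      by (simp only: power2_eq_square algebra_simps)
    thus "(inverse (of_nat (Suc n)) - inverse (1 + z + of_nat n)) -
      (inverse (of_nat (Suc n)) - inverse (1 - z + of_nat n)) = 2 * z / (of_nat (Suc n) ^ 2 - z ^ 2)"
      using nz[of n] unfolding eq by (simp add: divide_simps del: of_nat_Suc) (simp add: algebra_simps)
  qed
  also have "Digamma (1 + z) - Digamma (1 - z) = 1 / z - of_real pi * cot (of_real pi * z)"
    using Digamma_plus1[OF z0(1)] Digamma_reflection[OF assms] by (simp add: add.commute algebra_simps)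
  finally show ?thesis .
qed

definition bose :: "real \<Rightarrow> real" where "bose x = 1 / (exp x - 1)"

text \<open>Subtracting the polar and constant terms at 0 leaves a function of order
  \<open>x\<close> there and bounded at infinity, so its Mellin integral converges for
  \<open>-1 < s < 0\<close>.\<close>

definition bose_reg :: "real \<Rightarrow> real" where "bose_reg x = bose x - 1 / x + 1 / 2"

lemma bose_pos: "x > 0 \<Longrightarrow> bose x > 0"
  by (simp add: bose_def)

lemma bose_sums:
  assumes "x > 0"
  shows "(\<lambda>n. exp (- (real (Suc n) * x))) sums bose x"
proof -
  have "(\<lambda>n. exp (-x) * exp (-x) ^ n) sums (exp (-x) * (1 / (1 - exp (-x))))"
    using assms by (intro sums_mult geometric_sums) auto
  moreover have "exp (-x) * (1 / (1 - exp (-x))) = bose x"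
    using assms by (simp add: bose_def exp_minus field_simps)
  moreover have "exp (-x) * exp (-x) ^ n = exp (- (real (Suc n) * x))" for n
    by (simp add: exp_of_nat_mult[symmetric] exp_add[symmetric] algebra_simps)
  ultimately show ?thesis by simp
qed

text \<open>This is the cotangent expansion on the imaginary axis, where the cotangent becomes the
  hyperbolic one of \<open>x / 2\<close>, equal to \<open>1 + 2 * bose x\<close>. The terms are
  positive, which later allows termwise integration.\<close>

lemma bose_reg_sums:
  assumes "x > 0"
  shows "(\<lambda>n. 2 * x / (x ^ 2 + (2 * pi * real (Suc n)) ^ 2)) sums bose_reg x"
proof -
  define z where "z = \<i> * of_real (x / (2 * pi))"
  have "z \<notin> \<int>"
    using assms by (auto simp: z_def complex_eq_iff elim!: Ints_cases)
  have cot: "cot (of_real pi * z) = - \<i> * of_real (1 + 2 * bose x)"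
  proof -
    define e where "e = exp (of_real (x / 2) :: complex)"
    have "Re e > 1" using assms unfolding e_def exp_of_real by simp
    hence "e \<noteq> 0" by auto
    have "\<i> * (of_real pi * z) = - of_real (x / 2)"
      by (simp add: z_def)
    hence cs: "cos (of_real pi * z) = (inverse e + e) / 2" "sin (of_real pi * z) = (inverse e - e) / (2 * \<i>)"
      by (simp_all add: cos_exp_eq sin_exp_eq e_def exp_minus)
    have e2: "complex_of_real (exp x) = e ^ 2"
      by (simp add: e_def exp_of_real[symmetric] exp_of_nat_mult[symmetric])
    have "exp x \<noteq> 1" using assms by simp
    hence e2_1: "e ^ 2 - 1 \<noteq> 0" using e2 by (metis eq_iff_diff_eq_0 of_real_eq_1_iff)
    have b: "complex_of_real (1 + 2 * bose x) = (e ^ 2 + 1) / (e ^ 2 - 1)"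
      using e2_1 assms by (simp add: bose_def e2 divide_simps)
    have e': "inverse e + e = (e ^ 2 + 1) / e" "inverse e - e = - ((e ^ 2 - 1) / e)"
      using \<open>e \<noteq> 0\<close> by (simp_all add: field_simps power2_eq_square)
    show ?thesis
      unfolding cot_def cs b e' using e2_1 \<open>e \<noteq> 0\<close> by (simp add: divide_simps)
  qed
  have "(\<lambda>n. 2 * z / (of_nat (Suc n) ^ 2 - z ^ 2)) sums (1 / z - of_real pi * (- \<i> * of_real (1 + 2 * bose x)))"
    using cot_partial_fractions[OF \<open>z \<notin> \<int>\<close>] unfolding cot .
  moreover have "1 / z - of_real pi * (- \<i> * of_real (1 + 2 * bose x)) = 2 * pi * \<i> * of_real (bose_reg x)"
    using assms by (simp add: z_def bose_reg_def field_simps)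
  moreover have "2 * z / (of_nat (Suc n) ^ 2 - z ^ 2) =
      2 * pi * \<i> * of_real (2 * x / (x ^ 2 + (2 * pi * real (Suc n)) ^ 2))" for n
  proof -
    have "complex_of_real (x ^ 2 + (2 * pi * real (Suc n)) ^ 2) \<noteq> 0"
      using assms by (metis add_pos_nonneg less_irrefl of_real_eq_0_iff zero_le_power2 zero_less_power)
    moreover have "of_nat (Suc n) ^ 2 - z ^ 2 =
        of_real (x ^ 2 + (2 * pi * real (Suc n)) ^ 2) / of_real ((2 * pi) ^ 2)"
      by (simp add: z_def field_simps del: of_nat_Suc)
    ultimately show ?thesis
      by (simp add: z_def divide_simps del: of_nat_Suc of_real_add) (simp add: power2_eq_square)
  qed
  ultimately have "(\<lambda>n. 2 * pi * \<i> * of_real (2 * x / (x ^ 2 + (2 * pi * real (Suc n)) ^ 2))) sums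
      (2 * pi * \<i> * of_real (bose_reg x))"
    by (simp only:)
  hence "(\<lambda>n. complex_of_real (2 * x / (x ^ 2 + (2 * pi * real (Suc n)) ^ 2))) sums of_real (bose_reg x)"
    by (subst (asm) sums_mult_iff) auto
  thus ?thesis by (simp only: sums_of_real_iff)
qed

lemma bose_reg_nonneg: "x > 0 \<Longrightarrow> bose_reg x \<ge> 0"
  using sums_le[OF _ sums_zero bose_reg_sums] by simp

section \<open>Mellin transforms on the positive half-line\<close>

lemma has_integral_sums_nonneg:
  fixes f :: "nat \<Rightarrow> 'a :: euclidean_space \<Rightarrow> real"
  assumes "\<And>n. (f n has_integral c n) S" "\<And>n x. x \<in> S \<Longrightarrow> 0 \<le> f n x"
    and "\<And>x. x \<in> S \<Longrightarrow> (\<lambda>n. f n x) sums g x" "c sums C"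
  shows "(g has_integral C) S"
  by (rule has_integral_monotone_convergence_increasing[where f = "\<lambda>N x. \<Sum>n<N. f n x" and x = "\<lambda>N. \<Sum>n<N. c n"])
     (use assms in \<open>auto simp: sums_def intro!: has_integral_sum\<close>)

lemma has_integral_change_of_variables_nonneg:
  fixes f g g' :: "real \<Rightarrow> real"
  assumes "S \<in> sets lebesgue" "\<And>x. x \<in> S \<Longrightarrow> (g has_field_derivative g' x) (at x within S)"
    and "inj_on g S" "\<And>x. x \<in> S \<Longrightarrow> 0 \<le> g' x"
    and "(f has_integral I) (g ` S)" "\<And>y. y \<in> g ` S \<Longrightarrow> 0 \<le> f y"
  shows "((\<lambda>x. g' x * f (g x)) has_integral I) S"
proof -
  have "f absolutely_integrable_on (g ` S)" "integral (g ` S) f = I"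
    using assms(5,6) by (auto simp: has_integral_iff intro!: nonnegative_absolutely_integrable_1)
  hence "(\<lambda>x. \<bar>g' x\<bar> * f (g x)) absolutely_integrable_on S \<and> integral S (\<lambda>x. \<bar>g' x\<bar> * f (g x)) = I"
    using has_absolute_integral_change_of_variables_1'[OF assms(1-3)] by blast
  hence "((\<lambda>x. \<bar>g' x\<bar> * f (g x)) has_integral I) S"
    by (auto simp: has_integral_iff absolutely_integrable_on_def)
  thus ?thesis
    by (rule has_integral_eq[rotated]) (use assms(4) in auto)
qed

lemma has_integral_Gamma_scaled:
  assumes "s > 0" "c > (0 :: real)"
  shows "((\<lambda>x. x powr (s - 1) * exp (- (c * x))) has_integral Gamma s * c powr (-s)) {0<..}"
proof -
  have "(\<lambda>x. c * x) ` {0<..} = {0<..}"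
  proof (intro equalityI subsetI)
    fix y :: real assume "y \<in> {0<..}"
    thus "y \<in> (\<lambda>x. c * x) ` {0<..}"
      using assms by (intro image_eqI[of _ _ "y / c"]) auto
  qed (use assms in auto)
  moreover have "((\<lambda>t. t powr (s - 1) / exp t) has_integral Gamma s) {0<..}"
    using Gamma_integral_real[OF assms(1)]
    by (subst (asm) has_integral_spike_set_eq[of _ "{0<..}"]) (auto intro: negligible_subset[of "{0}"])
  ultimately have "((\<lambda>t. t powr (s - 1) / exp t) has_integral Gamma s) ((\<lambda>x. c * x) ` {0<..})"
    by simp
  moreover have "((\<lambda>x. c * x) has_field_derivative c) (at x within {0<..})" for x
    by (auto intro!: derivative_eq_intros)
  moreover have "inj_on (\<lambda>x. c * x) {0<..}"
    using assms by (auto intro: inj_onI)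
  ultimately have "((\<lambda>x. c * ((c * x) powr (s - 1) / exp (c * x))) has_integral Gamma s) {0<..}"
    using has_integral_change_of_variables_nonneg[of "{0<..}" "\<lambda>x. c * x" "\<lambda>_. c"
        "\<lambda>t. t powr (s - 1) / exp t" "Gamma s"] assms by auto
  from has_integral_mult_right[OF this, of "c powr (-s)"]
  have "((\<lambda>x. c powr (-s) * (c * ((c * x) powr (s - 1) / exp (c * x)))) has_integral Gamma s * c powr (-s)) {0<..}"
    by (simp add: mult.commute)
  thus ?thesis
  proof (rule has_integral_eq[rotated])
    fix x :: real assume "x \<in> {0<..}"
    have "c powr (-s) * (c * c powr (s - 1)) = 1"
      using assms by (simp add: powr_minus powr_diff)
    thus "c powr (-s) * (c * ((c * x) powr (s - 1) / exp (c * x))) = x powr (s - 1) * exp (- (c * x))"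
      using \<open>x \<in> {0<..}\<close> assms by (simp add: powr_mult exp_minus field_simps)
  qed
qed

text \<open>The substitution \<open>t = x^2 / (x^2 + A^2)\<close> gives a Beta integral with
  \<open>a + b = 1\<close>, so the reflection formula evaluates it as
  \<open>pi / sin (pi * a)\<close> with \<open>a = (1 + s) / 2\<close>. The cosine of the functional
  equation originates here.\<close>

lemma has_integral_powr_over_quadratic:
  assumes s: "-1 < s" "s < 1" and "A > (0 :: real)"
  shows "((\<lambda>x. 2 * x powr s / (x ^ 2 + A ^ 2)) has_integral A powr (s - 1) * (pi / cos (pi * s / 2))) {0<..}"
proof -
  define a b where "a = (1 + s) / 2" and "b = (1 - s) / 2"
  define g where "g = (\<lambda>x. x ^ 2 / (x ^ 2 + A ^ 2))"
  define g' where "g' = (\<lambda>x. 2 * x * A ^ 2 / (x ^ 2 + A ^ 2) ^ 2)"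
  have ab: "a > 0" "b > 0" "a + b = 1" using s by (auto simp: a_def b_def field_simps)
  have D: "x ^ 2 + A ^ 2 > 0" for x
    using \<open>A > 0\<close> by (intro add_nonneg_pos) auto
  have "Beta a b = pi / cos (pi * s / 2)"
  proof -
    have "b = 1 - a" using ab by simp
    hence "Beta a b = Gamma a * Gamma (1 - a)" by (simp add: Beta_def)
    hence "complex_of_real (Beta a b) = Gamma (of_real a) * Gamma (1 - of_real a)"
      by (simp only: of_real_mult Gamma_complex_of_real[symmetric] of_real_diff of_real_1)
    also have "\<dots> = of_real (pi / sin (pi * a))"
      by (simp add: Gamma_reflection_complex sin_of_real[symmetric])
    also have "sin (pi * a) = cos (pi * s / 2)"
      by (simp add: a_def sin_cos_eq field_simps)
    finally show ?thesis by (simp only: of_real_eq_iff)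
  qed
  hence "((\<lambda>t. t powr (a - 1) * (1 - t) powr (b - 1)) has_integral pi / cos (pi * s / 2)) {0<..<1}"
    using has_integral_Beta_real[OF ab(1,2)] by (simp add: has_integral_Icc_iff_Ioo)
  moreover have "g ` {0<..} = {0<..<1}"
  proof (intro equalityI subsetI)
    fix y assume "y \<in> g ` {0<..}"
    thus "y \<in> {0<..<1}" using D \<open>A > 0\<close> by (auto simp: g_def)
  next
    fix y :: real assume y: "y \<in> {0<..<1}"
    define x where "x = A * sqrt (y / (1 - y))"
    have "x ^ 2 = A ^ 2 * (y / (1 - y))" using y by (simp add: x_def power_mult_distrib)
    hence "g x = y" using y \<open>A > 0\<close> by (simp add: g_def field_simps)
    moreover have "x > 0" using y \<open>A > 0\<close> by (simp add: x_def)
    ultimately show "y \<in> g ` {0<..}" by force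
  qed
  moreover have "inj_on g {0<..}"
  proof (rule inj_onI)
    fix x y assume xy: "x \<in> {0<..}" "y \<in> {0<..}" "g x = g y"
    hence "x ^ 2 * (y ^ 2 + A ^ 2) = y ^ 2 * (x ^ 2 + A ^ 2)"
      using D[of x] D[of y] by (simp add: g_def field_simps)
    hence "x ^ 2 = y ^ 2" using \<open>A > 0\<close> by (simp add: algebra_simps)
    thus "x = y" using xy by (simp add: power2_eq_iff)
  qed
  moreover have "(g has_field_derivative g' x) (at x within {0<..})" for x
    unfolding g_def g'_def using D[of x]
    by (auto intro!: derivative_eq_intros simp: power2_eq_square field_simps)
  ultimately have "((\<lambda>x. g' x * (g x powr (a - 1) * (1 - g x) powr (b - 1))) has_integral pi / cos (pi * s / 2)) {0<..}"
    using has_integral_change_of_variables_nonneg[of "{0<..}" g g'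
        "\<lambda>t. t powr (a - 1) * (1 - t) powr (b - 1)" "pi / cos (pi * s / 2)"] \<open>A > 0\<close>
    by (auto simp: g'_def)
  hence "((\<lambda>x. A powr (s - 1) * (g' x * (g x powr (a - 1) * (1 - g x) powr (b - 1)))) has_integral
      A powr (s - 1) * (pi / cos (pi * s / 2))) {0<..}"
    by (rule has_integral_mult_right)
  thus ?thesis
  proof (rule has_integral_eq[rotated])
    fix x :: real assume "x \<in> {0<..}"
    hence x: "x > 0" by simp
    define D where "D = x ^ 2 + A ^ 2"
    have "D > 0" using D by (simp add: D_def)
    have g1: "g x = x powr 2 / D" "1 - g x = A powr 2 / D"
      using \<open>D > 0\<close> x \<open>A > 0\<close> by (simp_all add: g_def D_def field_simps powr_numeral)
    have pw: "(y powr 2 / D) powr e = y powr (2 * e) * D powr (- e)" if "y > 0" for y e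
      using that \<open>D > 0\<close> by (simp add: powr_divide powr_powr powr_minus_divide del: powr_numeral)
    have e: "2 * (a - 1) = s - 1" "- (a - 1) = (1 - s) / 2" "2 * (b - 1) = -1 - s" "- (b - 1) = (1 + s) / 2"
      by (simp_all add: a_def b_def field_simps)
    have gx: "g x powr (a - 1) = x powr (s - 1) * D powr ((1 - s) / 2)"
      unfolding g1(1) pw[OF x] e ..
    have gx': "(1 - g x) powr (b - 1) = A powr (-1 - s) * D powr ((1 + s) / 2)"
      unfolding g1(2) pw[OF \<open>A > 0\<close>] e ..
    have D1: "D powr ((1 - s) / 2) * D powr ((1 + s) / 2) = D"
      using \<open>D > 0\<close> by (simp add: powr_add[symmetric] field_simps)
    have A1: "A powr (s - 1) * A powr (-1 - s) * A ^ 2 = 1"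
      using \<open>A > 0\<close> by (simp add: powr_add[symmetric] powr_minus powr_numeral)
    have x1: "x powr (s - 1) * x = x powr s"
      using x by (simp add: powr_diff)
    have g'x: "g' x = 2 * x * A ^ 2 / D ^ 2" by (simp add: g'_def D_def)
    have "A powr (s - 1) * (g' x * (g x powr (a - 1) * (1 - g x) powr (b - 1))) =
      (A powr (s - 1) * A powr (-1 - s) * A ^ 2) * (2 * (x powr (s - 1) * x) * (D powr ((1 - s) / 2) * D powr ((1 + s) / 2)) / D ^ 2)"
      unfolding gx gx' g'x by (simp only: divide_inverse mult_ac)
    also have "\<dots> = 2 * x powr s / D"
      unfolding A1 x1 D1
      using \<open>D > 0\<close> by (simp add: power2_eq_square)
    finally show "A powr (s - 1) * (g' x * (g x powr (a - 1) * (1 - g x) powr (b - 1))) = 2 * x powr s / (x ^ 2 + A ^ 2)"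
      by (simp add: D_def)
  qed
qed

lemma has_integral_bose:
  assumes "s > 1"
  shows "((\<lambda>x. x powr (s - 1) * bose x) has_integral Gamma s * (\<Sum>n. real (Suc n) powr (-s))) {0<..}"
proof (rule has_integral_sums_nonneg)
  show "((\<lambda>x. x powr (s - 1) * exp (- (real (Suc n) * x))) has_integral Gamma s * real (Suc n) powr (-s)) {0<..}" for n
    using assms by (intro has_integral_Gamma_scaled) auto
  show "(\<lambda>n. x powr (s - 1) * exp (- (real (Suc n) * x))) sums (x powr (s - 1) * bose x)" if "x \<in> {0<..}" for x
    using that by (intro sums_mult bose_sums) auto
  show "(\<lambda>n. Gamma s * real (Suc n) powr (-s)) sums (Gamma s * (\<Sum>n. real (Suc n) powr (-s)))"
    by (rule sums_mult[OF summable_sums[OF summable_nat_powr[OF assms]]])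
qed simp

text \<open>Integrating the expansion of \<open>bose_reg\<close> term by term produces the powers
  \<open>(2 * pi * n) powr (s - 1)\<close>, hence the zeta value at \<open>1 - s\<close>: the
  reflected side of the functional equation.\<close>

lemma has_integral_bose_reg:
  assumes s: "-1 < s" "s < 0"
  shows "((\<lambda>x. x powr (s - 1) * bose_reg x) has_integral
    (2 * pi) powr (s - 1) * (pi / cos (pi * s / 2)) * (\<Sum>n. real (Suc n) powr (s - 1))) {0<..}"
proof (rule has_integral_sums_nonneg)
  show "((\<lambda>x. 2 * x powr s / (x ^ 2 + (2 * pi * real (Suc n)) ^ 2)) has_integral
      (2 * pi) powr (s - 1) * (pi / cos (pi * s / 2)) * real (Suc n) powr (s - 1)) {0<..}" for n
  proof -
    have "((\<lambda>x. 2 * x powr s / (x ^ 2 + (2 * pi * real (Suc n)) ^ 2)) has_integral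
        (2 * pi * real (Suc n)) powr (s - 1) * (pi / cos (pi * s / 2))) {0<..}"
      using s by (intro has_integral_powr_over_quadratic) auto
    also have "(2 * pi * real (Suc n)) powr (s - 1) = (2 * pi) powr (s - 1) * real (Suc n) powr (s - 1)"
      by (rule powr_mult)
    finally show ?thesis by (simp only: mult_ac)
  qed
  show "(\<lambda>n. 2 * x powr s / (x ^ 2 + (2 * pi * real (Suc n)) ^ 2)) sums (x powr (s - 1) * bose_reg x)"
    if "x \<in> {0<..}" for x
  proof -
    have *: "x powr (s - 1) * (2 * x / (x ^ 2 + (2 * pi * real (Suc n)) ^ 2)) =
        2 * x powr s / (x ^ 2 + (2 * pi * real (Suc n)) ^ 2)" for n
      using that by (simp add: powr_diff)
    have "x > 0" using that by simp
    from sums_mult[OF bose_reg_sums[OF this], of "x powr (s - 1)"] show ?thesis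
      unfolding * .
  qed
  have "summable (\<lambda>n. real (Suc n) powr (s - 1))"
    using summable_nat_powr[of "1 - s"] s by simp
  thus "(\<lambda>n. (2 * pi) powr (s - 1) * (pi / cos (pi * s / 2)) * real (Suc n) powr (s - 1)) sums
      ((2 * pi) powr (s - 1) * (pi / cos (pi * s / 2)) * (\<Sum>n. real (Suc n) powr (s - 1)))"
    by (rule sums_mult[OF summable_sums])
qed simp

lemma borel_measurable_lebesgue_on: "f \<in> borel_measurable borel \<Longrightarrow> f \<in> borel_measurable (lebesgue_on S)"
  by (intro measurable_restrict_space1 measurable_completion) simp

lemma borel_measurable_bose [measurable]: "bose \<in> borel_measurable borel" "bose_reg \<in> borel_measurable borel"
  unfolding bose_reg_def[abs_def] bose_def[abs_def] by measurable

lemma exp_ln_over: "x > 0 \<Longrightarrow> c / x * exp (s * ln x) = x powr (s - 1) * c" for c s x :: real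
  by (simp add: powr_def exp_diff left_diff_distrib)

section \<open>The Mellin integral split at 1\<close>

definition zeta_low :: "complex \<Rightarrow> complex" where
  "zeta_low s = (\<integral>x. of_real (bose_reg x / x) * exp (s * of_real (ln x)) \<partial>lebesgue_on {0<..1})"

text \<open>Only the behaviour at 0 restricts \<open>s\<close>: \<open>bose\<close> decays
  exponentially, so this half is entire. The power of \<open>x\<close> is written as an exponential
  in \<open>s\<close> to fit \<open>holomorphic_integral_exp\<close>.\<close>

definition zeta_high :: "complex \<Rightarrow> complex" where
  "zeta_high s = (\<integral>x. of_real (bose x / x) * exp (s * of_real (ln x)) \<partial>lebesgue_on {1<..})"

lemma integrable_zeta_low:
  assumes "s > -1"
  shows "integrable (lebesgue_on {0<..1}) (\<lambda>x. bose_reg x / x * exp (s * ln x))"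
proof -
  \<comment> \<open>Any exponent in \<open>(-1, 0)\<close> not above \<open>s\<close> would do: the
    integral over the half-line is finite there, and for \<open>x \<le> 1\<close> a smaller exponent
    gives a larger power.\<close>
  define t where "t = min s (-1/2)"
  have t: "-1 < t" "t < 0" "t \<le> s" using assms by (auto simp: t_def)
  have "(\<lambda>x. x powr (t - 1) * bose_reg x) absolutely_integrable_on {0<..}"
    using has_integral_bose_reg[OF t(1,2)] bose_reg_nonneg
    by (intro nonnegative_absolutely_integrable_1) (auto simp: has_integral_iff)
  hence "(\<lambda>x. x powr (t - 1) * bose_reg x) absolutely_integrable_on {0<..1}"
    by (rule set_integrable_subset) auto
  hence int: "integrable (lebesgue_on {0<..1}) (\<lambda>x. x powr (t - 1) * bose_reg x)"
    by (rule absolutely_integrable_imp_integrable) simp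
  show ?thesis
  proof (rule Bochner_Integration.integrable_bound[OF int])
    show "(\<lambda>x. bose_reg x / x * exp (s * ln x)) \<in> borel_measurable (lebesgue_on {0<..1})"
      by (rule borel_measurable_lebesgue_on) measurable
    have "norm (bose_reg x / x * exp (s * ln x)) \<le> norm (x powr (t - 1) * bose_reg x)" if "x \<in> {0<..1}" for x
    proof -
      have "x powr (s - 1) \<le> x powr (t - 1)" using that t by (intro powr_mono') auto
      moreover have "bose_reg x \<ge> 0" using that bose_reg_nonneg by auto
      ultimately show ?thesis
        using that by (subst exp_ln_over) (auto simp: abs_mult intro!: mult_right_mono)
    qed
    thus "AE x in lebesgue_on {0<..1}. norm (bose_reg x / x * exp (s * ln x)) \<le> norm (x powr (t - 1) * bose_reg x)"
      by (intro AE_I2) simp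
  qed
qed

lemma integrable_zeta_high:
  "integrable (lebesgue_on {1<..}) (\<lambda>x. bose x / x * exp (s * ln x))"
proof -
  \<comment> \<open>Any exponent above 1 and not below \<open>s\<close> would do, since for
    \<open>x > 1\<close> a larger exponent gives a larger power.\<close>
  define t where "t = max s 2"
  have t: "t > 1" "s \<le> t" by (auto simp: t_def)
  have "(\<lambda>x. x powr (t - 1) * bose x) absolutely_integrable_on {0<..}"
    using has_integral_bose[OF t(1)] bose_pos
    by (intro nonnegative_absolutely_integrable_1) (auto simp: has_integral_iff less_imp_le)
  hence "(\<lambda>x. x powr (t - 1) * bose x) absolutely_integrable_on {1<..}"
    by (rule set_integrable_subset) auto
  hence int: "integrable (lebesgue_on {1<..}) (\<lambda>x. x powr (t - 1) * bose x)"
    by (rule absolutely_integrable_imp_integrable) simp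
  show ?thesis
  proof (rule Bochner_Integration.integrable_bound[OF int])
    show "(\<lambda>x. bose x / x * exp (s * ln x)) \<in> borel_measurable (lebesgue_on {1<..})"
      by (rule borel_measurable_lebesgue_on) measurable
    have "norm (bose x / x * exp (s * ln x)) \<le> norm (x powr (t - 1) * bose x)" if "x \<in> {1<..}" for x
    proof -
      have "x powr (s - 1) \<le> x powr (t - 1)" using that t by (intro powr_mono) auto
      moreover have "bose x > 0" using that by (intro bose_pos) auto
      ultimately show ?thesis
        using that by (subst exp_ln_over) (auto simp: abs_mult intro!: mult_right_mono)
    qed
    thus "AE x in lebesgue_on {1<..}. norm (bose x / x * exp (s * ln x)) \<le> norm (x powr (t - 1) * bose x)"
      by (intro AE_I2) simp
  qed
qed

lemma holomorphic_zeta_low: "zeta_low holomorphic_on {s. Re s > -1}"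
proof -
  have "(\<lambda>x. bose_reg x / x) \<in> borel_measurable (lebesgue_on {0<..1})" "(ln :: real \<Rightarrow> real) \<in> borel_measurable (lebesgue_on {0<..1})"
    using borel_measurable_ln[of "\<lambda>x. x" borel] by (auto intro!: borel_measurable_lebesgue_on)
  from holomorphic_integral_exp[OF this open_greaterThan[of "-1"] integrable_zeta_low]
  show ?thesis by (simp add: zeta_low_def[abs_def])
qed

lemma holomorphic_zeta_high: "zeta_high holomorphic_on UNIV"
proof -
  have "(\<lambda>x. bose x / x) \<in> borel_measurable (lebesgue_on {1<..})" "(ln :: real \<Rightarrow> real) \<in> borel_measurable (lebesgue_on {1<..})"
    using borel_measurable_ln[of "\<lambda>x. x" borel] by (auto intro!: borel_measurable_lebesgue_on)
  from holomorphic_integral_exp[OF this open_UNIV integrable_zeta_high]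
  show ?thesis by (simp add: zeta_high_def[abs_def])
qed

lemma has_integral_zeta_low:
  assumes "s > -1"
  shows "((\<lambda>x. x powr (s - 1) * bose_reg x) has_integral Re (zeta_low (of_real s))) {0<..1}"
    and "Im (zeta_low (of_real s)) = 0"
proof -
  have "of_real (bose_reg x / x) * exp (of_real s * of_real (ln x)) =
      complex_of_real (bose_reg x / x * exp (s * ln x))" for x
    by (simp add: exp_of_real[symmetric])
  hence eq: "zeta_low (of_real s) = of_real (\<integral>x. bose_reg x / x * exp (s * ln x) \<partial>lebesgue_on {0<..1})"
    unfolding zeta_low_def by (simp only: integral_complex_of_real)
  thus "Im (zeta_low (of_real s)) = 0" by simp
  have "((\<lambda>x. bose_reg x / x * exp (s * ln x)) has_integral Re (zeta_low (of_real s))) {0<..1}"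
    unfolding eq Re_complex_of_real by (rule has_integral_integral_lebesgue_on[OF integrable_zeta_low[OF assms]]) simp
  thus "((\<lambda>x. x powr (s - 1) * bose_reg x) has_integral Re (zeta_low (of_real s))) {0<..1}"
    by (rule has_integral_eq[rotated]) (rule exp_ln_over, simp)
qed

lemma has_integral_zeta_high:
  shows "((\<lambda>x. x powr (s - 1) * bose x) has_integral Re (zeta_high (of_real s))) {1<..}"
    and "Im (zeta_high (of_real s)) = 0"
proof -
  have "of_real (bose x / x) * exp (of_real s * of_real (ln x)) =
      complex_of_real (bose x / x * exp (s * ln x))" for x
    by (simp add: exp_of_real[symmetric])
  hence eq: "zeta_high (of_real s) = of_real (\<integral>x. bose x / x * exp (s * ln x) \<partial>lebesgue_on {1<..})"
    unfolding zeta_high_def by (simp only: integral_complex_of_real)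
  thus "Im (zeta_high (of_real s)) = 0" by simp
  have "((\<lambda>x. bose x / x * exp (s * ln x)) has_integral Re (zeta_high (of_real s))) {1<..}"
    unfolding eq Re_complex_of_real by (rule has_integral_integral_lebesgue_on[OF integrable_zeta_high]) simp
  thus "((\<lambda>x. x powr (s - 1) * bose x) has_integral Re (zeta_high (of_real s))) {1<..}"
    by (rule has_integral_eq[rotated]) (rule exp_ln_over, simp)
qed

lemma has_integral_remove_point:
  fixes f :: "real \<Rightarrow> real"
  assumes "(f has_integral I) S"
  shows "(f has_integral I) (S - {a})"
proof -
  have "negligible {x \<in> S - (S - {a}). f x \<noteq> 0}" "negligible {x \<in> S - {a} - S. f x \<noteq> 0}"
    by (auto intro: negligible_subset[of "{a}"])
  thus ?thesis using assms has_integral_spike_set_eq by blast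
qed

lemma has_integral_low_high_Un:
  fixes f :: "real \<Rightarrow> real"
  assumes "(f has_integral a) {0<..1}" "(f has_integral b) {1<..}"
  shows "(f has_integral a + b) {0<..}"
proof -
  have "(f has_integral a + b) ({0<..1} \<union> {1<..})"
    using assms by (rule has_integral_Un) (auto simp: negligible_empty intro!: negligible_subset[of "{}"])
  also have "{0<..1} \<union> {1<..} = {0 :: real<..}" by auto
  finally show ?thesis .
qed

text \<open>On \<open>Re s > -1\<close> this is \<open>\<Gamma>(s) \<zeta>(s)\<close>: the integral of \<open>x powr (s - 1) / (exp x - 1)\<close> over the
  positive axis, with the first two terms of the expansion of \<open>1 / (exp x - 1)\<close> at 0 integrated
  explicitly over the unit interval.\<close>

definition Gamma_zeta_mid :: "complex \<Rightarrow> complex" where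
  "Gamma_zeta_mid s = zeta_low s + zeta_high s + 1 / (s - 1) - 1 / (2 * s)"

text \<open>The functional equation makes this equal to \<open>\<Gamma>(s) \<zeta>(s)\<close> on \<open>Re s < 0\<close>.\<close>

definition Gamma_zeta_left :: "complex \<Rightarrow> complex" where
  "Gamma_zeta_left s = of_real (2 * pi) powr s * zeta_series (1 - s) / (2 * cos (of_real pi * s / 2))"

lemma Gamma_zeta_mid_real_right:
  fixes s :: real
  assumes "s > 1"
  shows "Gamma_zeta_mid (of_real s) = Gamma (of_real s) * zeta_series (of_real s)"
proof -
  have Ioc: "{0..1} - {0} = {0 :: real<..1}" by auto
  have p1: "((\<lambda>x. x powr (s - 2)) has_integral 1 / (s - 1)) {0<..1}"
    using has_integral_remove_point[OF has_integral_powr_from_0[of "s - 2" 1], of 0] assms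
    by (simp add: Ioc)
  have p2: "((\<lambda>x. x powr (s - 1)) has_integral 1 / s) {0<..1}"
    using has_integral_remove_point[OF has_integral_powr_from_0[of "s - 1" 1], of 0] assms
    by (simp add: Ioc)
  have "s > -1" using assms by simp
  from has_integral_diff[OF has_integral_add[OF has_integral_zeta_low(1)[OF this] p1] has_integral_mult_right[OF p2, of "1 / 2"]]
  have "((\<lambda>x. x powr (s - 1) * bose_reg x + x powr (s - 2) - 1 / 2 * x powr (s - 1)) has_integral
      (Re (zeta_low (of_real s)) + 1 / (s - 1) - 1 / 2 * (1 / s))) {0<..1}" .
  hence "((\<lambda>x. x powr (s - 1) * bose x) has_integral
      (Re (zeta_low (of_real s)) + 1 / (s - 1) - 1 / 2 * (1 / s))) {0<..1}"
  proof (rule has_integral_eq[rotated])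
    fix x :: real assume "x \<in> {0<..1}"
    hence "x powr (s - 2) = x powr (s - 1) / x"
      using powr_diff[of x "s - 1" 1] by simp
    thus "x powr (s - 1) * bose_reg x + x powr (s - 2) - 1 / 2 * x powr (s - 1) = x powr (s - 1) * bose x"
      by (simp add: bose_reg_def algebra_simps)
  qed
  from has_integral_unique[OF has_integral_low_high_Un[OF this has_integral_zeta_high(1)] has_integral_bose[OF assms]]
  have eq: "Re (zeta_low (of_real s)) + 1 / (s - 1) - 1 / 2 * (1 / s) + Re (zeta_high (of_real s)) =
      Gamma s * (\<Sum>n. real (Suc n) powr (-s))" .
  have "Gamma_zeta_mid (of_real s) = of_real (Re (zeta_low (of_real s)) + 1 / (s - 1) - 1 / 2 * (1 / s) + Re (zeta_high (of_real s)))"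
    using has_integral_zeta_low(2)[OF \<open>s > -1\<close>] has_integral_zeta_high(2)[of s]
    by (simp add: Gamma_zeta_mid_def complex_eq_iff)
  also have "\<dots> = Gamma (of_real s) * zeta_series (of_real s)"
    unfolding eq by (simp only: of_real_mult Gamma_complex_of_real[symmetric] zeta_series_of_real(1)[OF assms])
  finally show ?thesis .
qed

text \<open>The same rational terms now come from the other interval. For \<open>s > 1\<close> they
  integrate \<open>1 / x - 1 / 2\<close> over \<open>(0, 1]\<close>; for \<open>s < 0\<close> they
  integrate its negative over \<open>(1, \<infinity>)\<close>. With them \<open>zeta_low\<close> and
  \<open>zeta_high\<close> add up to the Mellin integral of \<open>bose_reg\<close>, already
  evaluated.\<close>

lemma Gamma_zeta_mid_real_left:
  fixes s :: real
  assumes s: "-1 < s" "s < 0"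
  shows "Gamma_zeta_mid (of_real s) = Gamma_zeta_left (of_real s)"
proof -
  have Ioi: "{1..} - {1} = {1 :: real<..}" by auto
  have p1: "((\<lambda>x. x powr (s - 2)) has_integral - 1 / (s - 1)) {1<..}"
    using has_integral_remove_point[OF has_integral_powr_to_inf[of "s - 2" 1], of 1] s
    by (simp add: Ioi)
  have p2: "((\<lambda>x. x powr (s - 1)) has_integral - 1 / s) {1<..}"
    using has_integral_remove_point[OF has_integral_powr_to_inf[of "s - 1" 1], of 1] s
    by (simp add: Ioi)
  from has_integral_add[OF has_integral_diff[OF has_integral_zeta_high(1) p1] has_integral_mult_right[OF p2, of "1 / 2"]]
  have "((\<lambda>x. x powr (s - 1) * bose x - x powr (s - 2) + 1 / 2 * x powr (s - 1)) has_integral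
      (Re (zeta_high (of_real s)) - (- 1 / (s - 1)) + 1 / 2 * (- 1 / s))) {1<..}" .
  hence "((\<lambda>x. x powr (s - 1) * bose_reg x) has_integral
      (Re (zeta_high (of_real s)) - (- 1 / (s - 1)) + 1 / 2 * (- 1 / s))) {1<..}"
  proof (rule has_integral_eq[rotated])
    fix x :: real assume "x \<in> {1<..}"
    hence "x powr (s - 2) = x powr (s - 1) / x"
      using powr_diff[of x "s - 1" 1] by simp
    thus "x powr (s - 1) * bose x - x powr (s - 2) + 1 / 2 * x powr (s - 1) = x powr (s - 1) * bose_reg x"
      by (simp add: bose_reg_def algebra_simps)
  qed
  from has_integral_unique[OF has_integral_low_high_Un[OF has_integral_zeta_low(1)[OF s(1)] this] has_integral_bose_reg[OF s]]
  have eq: "Re (zeta_low (of_real s)) + (Re (zeta_high (of_real s)) - (- 1 / (s - 1)) + 1 / 2 * (- 1 / s)) =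
      (2 * pi) powr (s - 1) * (pi / cos (pi * s / 2)) * (\<Sum>n. real (Suc n) powr (s - 1))" .
  have "Gamma_zeta_mid (of_real s) =
      of_real (Re (zeta_low (of_real s)) + (Re (zeta_high (of_real s)) - (- 1 / (s - 1)) + 1 / 2 * (- 1 / s)))"
    using has_integral_zeta_low(2)[OF s(1)] has_integral_zeta_high(2)[of s]
    by (simp add: Gamma_zeta_mid_def complex_eq_iff)
  also have "\<dots> = of_real ((2 * pi) powr s * (\<Sum>n. real (Suc n) powr (- (1 - s))) / (2 * cos (pi * s / 2)))"
    unfolding eq by (simp add: powr_diff)
  also have "\<dots> = Gamma_zeta_left (of_real s)"
  proof -
    have "zeta_series (1 - of_real s) = of_real (\<Sum>n. real (Suc n) powr (- (1 - s)))"
      using zeta_series_of_real(1)[of "1 - s"] s by simp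
    moreover have "of_real (2 * pi) powr of_real s = complex_of_real ((2 * pi) powr s)"
      by (rule powr_of_real) simp
    moreover have "cos (of_real pi * of_real s / 2) = complex_of_real (cos (pi * s / 2))"
      by (simp add: cos_of_real[symmetric])
    ultimately show ?thesis by (simp add: Gamma_zeta_left_def)
  qed
  finally show ?thesis .
qed

section \<open>From the real axis to the complex plane\<close>

lemma of_real_islimpt_interval:
  assumes "a < x" "x < b"
  shows "complex_of_real x islimpt (of_real ` {a<..<b})"
  unfolding islimpt_approachable
proof (intro allI impI)
  fix e :: real assume "e > 0"
  define y where "y = x + min (e / 2) ((b - x) / 2)"
  have "x < y" "y < b" "y - x < e"
    using assms \<open>e > 0\<close> by (auto simp: y_def min_def field_simps)
  thus "\<exists>x'\<in>complex_of_real ` {a<..<b}. x' \<noteq> of_real x \<and> dist x' (of_real x) < e"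
    using assms by (intro bexI[of _ "of_real y"]) (auto simp: dist_of_real dist_real_def)
qed

lemma convex_Re_strip: "convex {s. Re s > c}" "convex {s. c < Re s \<and> Re s < d}"
proof -
  show *: "convex {s. Re s > c}" by (rule convex_halfspace_Re_gt)
  have "{s. c < Re s \<and> Re s < d} = {s. Re s > c} \<inter> {s. Re s < d}" by auto
  thus "convex {s. c < Re s \<and> Re s < d}"
    using * convex_halfspace_Re_lt by (auto intro: convex_Int)
qed

lemma Gamma_zeta_mid_right:
  assumes "Re s > 1"
  shows "Gamma_zeta_mid s = Gamma s * zeta_series s"
proof -
  have "Gamma_zeta_mid s - Gamma s * zeta_series s = 0"
  proof (rule analytic_continuation[where f = "\<lambda>s. Gamma_zeta_mid s - Gamma s * zeta_series s" and S = "{s. Re s > 1}" and U = "complex_of_real ` {1<..<3}" and \<xi> = "of_real 2"])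
    have "s \<noteq> 0" "s \<noteq> 1" "s \<notin> \<int>\<^sub>\<le>\<^sub>0" if "Re s > 1" for s
      using that by (auto elim!: nonpos_Ints_cases)
    thus "(\<lambda>s. Gamma_zeta_mid s - Gamma s * zeta_series s) holomorphic_on {s. Re s > 1}"
      unfolding Gamma_zeta_mid_def
      by (intro holomorphic_intros holomorphic_on_subset[OF holomorphic_zeta_low]
          holomorphic_on_subset[OF holomorphic_zeta_high]) auto
    show "Gamma_zeta_mid z - Gamma z * zeta_series z = 0" if "z \<in> complex_of_real ` {1<..<3}" for z
      using that Gamma_zeta_mid_real_right by auto
    show "of_real 2 islimpt complex_of_real ` {1<..<3}"
      by (rule of_real_islimpt_interval) auto
  qed (use assms open_halfspace_Re_gt convex_Re_strip in \<open>auto intro: convex_connected\<close>)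
  thus ?thesis by simp
qed

lemma cos_pi_half_nonzero:
  assumes "-1 < Re s" "Re s < 1"
  shows "cos (of_real pi * s / 2) \<noteq> 0"
proof
  assume "cos (of_real pi * s / 2) = 0"
  then obtain n :: int where "of_real pi * s / 2 = of_real (n * pi) + of_real pi / 2"
    by (auto simp: cos_eq_0)
  hence "of_real pi * s = of_real pi * of_real (2 * n + 1)"
    by (simp add: field_simps)
  hence "s = of_real (2 * n + 1)" by simp
  hence "Re s = of_int (2 * n + 1)" by simp
  with assms have "real_of_int (- 1) < of_int (2 * n + 1)" "real_of_int (2 * n + 1) < of_int 1"
    by simp_all
  thus False unfolding of_int_less_iff by presburger
qed

lemma Gamma_zeta_mid_left:
  assumes "-1 < Re s" "Re s < 0"
  shows "Gamma_zeta_mid s = Gamma_zeta_left s"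
proof -
  let ?S = "{s. -1 < Re s \<and> Re s < 0}"
  have "?S = {s. Re s > -1} \<inter> {s. Re s < 0}" by auto
  hence "open ?S" by (simp add: open_Int open_halfspace_Re_gt open_halfspace_Re_lt)
  have "Gamma_zeta_mid s - Gamma_zeta_left s = 0"
  proof (rule analytic_continuation[where f = "\<lambda>s. Gamma_zeta_mid s - Gamma_zeta_left s" and S = ?S and U = "complex_of_real ` {-1<..<0}" and \<xi> = "of_real (-1/2)"])
    have "s \<noteq> 0" "s \<noteq> 1" "cos (of_real pi * s / 2) \<noteq> 0" if "s \<in> ?S" for s
      using that cos_pi_half_nonzero[of s] by auto
    thus "(\<lambda>s. Gamma_zeta_mid s - Gamma_zeta_left s) holomorphic_on ?S"
      unfolding Gamma_zeta_mid_def Gamma_zeta_left_def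
      by (intro holomorphic_intros holomorphic_on_subset[OF holomorphic_zeta_low]
          holomorphic_on_subset[OF holomorphic_zeta_high]) auto
    show "Gamma_zeta_mid z - Gamma_zeta_left z = 0" if "z \<in> complex_of_real ` {-1<..<0}" for z
      using that Gamma_zeta_mid_real_left by auto
    show "of_real (-1/2) islimpt complex_of_real ` {-1<..<0}"
      by (rule of_real_islimpt_interval) auto
  qed (use assms \<open>open ?S\<close> convex_Re_strip in \<open>auto intro: convex_connected\<close>)
  thus ?thesis by simp
qed

text \<open>The two formulas agree for \<open>-1 < Re s < 0\<close>, so each of two overlapping open
  half-planes has a single formula. Values at poles are whatever division by zero yields;
  \<open>remove_sings\<close> normalises them once the L-function is assembled.\<close>

definition Gamma_zeta :: "complex \<Rightarrow> complex" where
  "Gamma_zeta s = (if Re s > -1 then Gamma_zeta_mid s else Gamma_zeta_left s)"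

lemma Gamma_zeta_right: "Re s > 1 \<Longrightarrow> Gamma_zeta s = Gamma s * zeta_series s"
  by (simp add: Gamma_zeta_def Gamma_zeta_mid_right)

lemma Gamma_zeta_left: "Re s < 0 \<Longrightarrow> Gamma_zeta s = Gamma_zeta_left s"
  by (simp add: Gamma_zeta_def Gamma_zeta_mid_left)

lemma meromorphic_Gamma_zeta: "Gamma_zeta meromorphic_on UNIV"
proof -
  have "Gamma_zeta_mid meromorphic_on {s. Re s > -1}"
    unfolding Gamma_zeta_mid_def[abs_def] using holomorphic_zeta_low holomorphic_zeta_high open_halfspace_Re_gt[of "-1"]
    by (intro meromorphic_intros analytic_on_imp_meromorphic_on)
       (auto simp: analytic_on_open intro: holomorphic_on_subset)
  moreover have "eventually (\<lambda>w. Gamma_zeta w = Gamma_zeta_mid w) (at z)" if "z \<in> {s. Re s > -1}" for z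
    using eventually_at_in_open'[OF open_halfspace_Re_gt that]
    by eventually_elim (auto simp: Gamma_zeta_def)
  ultimately have right: "Gamma_zeta meromorphic_on {s. Re s > -1}"
    by (subst meromorphic_on_cong) auto
  have open_left: "open {s. Re s < 0}" by (rule open_halfspace_Re_lt)
  have "(\<lambda>s. zeta_series (1 - s)) holomorphic_on {s. Re s < 0}"
    by (intro holomorphic_intros) auto
  hence "(\<lambda>s. zeta_series (1 - s)) analytic_on {s. Re s < 0}"
    using open_left by (simp add: analytic_on_open)
  moreover have "complex_of_real (2 * pi) \<notin> \<real>\<^sub>\<le>\<^sub>0"
    using pi_gt_zero unfolding complex_nonpos_Reals_iff Re_complex_of_real by linarith
  ultimately have "Gamma_zeta_left meromorphic_on {s. Re s < 0}"
    unfolding Gamma_zeta_left_def[abs_def]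
    by (intro meromorphic_on_divide meromorphic_on_mult analytic_on_imp_meromorphic_on analytic_intros)
       (auto simp del: of_real_mult)
  moreover have "eventually (\<lambda>w. Gamma_zeta w = Gamma_zeta_left w) (at z)" if "z \<in> {s. Re s < 0}" for z
    using eventually_at_in_open'[OF open_left that]
    by eventually_elim (auto simp: Gamma_zeta_left)
  ultimately have "Gamma_zeta meromorphic_on {s. Re s < 0}"
    by (subst meromorphic_on_cong) auto
  moreover have "UNIV = {s. Re s > -1} \<union> {s. Re s < 0}" by auto
  ultimately show ?thesis
    using meromorphic_on_Un[OF right] by metis
qed

section \<open>The L-function of the Eisenstein series\<close>

lemma summable_pow_mult_power:
  fixes x :: real
  assumes "norm x < 1"
  shows "summable (\<lambda>n. real n ^ j * x ^ n)"
  using assms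
proof (induction j arbitrary: x)
  case 0
  thus ?case by (simp add: summable_geometric)
next
  case (Suc j)
  have "summable (\<lambda>n. diffs (\<lambda>n. real n ^ j) n * x ^ n)"
    using Suc by (intro termdiff_converges[of x 1]) auto
  from summable_mult[OF this, of x] have "summable (\<lambda>n. real (Suc n) ^ Suc j * x ^ Suc n)"
    by (simp add: diffs_def algebra_simps)
  thus ?case by (subst (asm) summable_Suc_iff)
qed

lemma divisor_sigma_le: "n > 0 \<Longrightarrow> divisor_sigma r n \<le> n ^ Suc r"
proof -
  assume n: "n > 0"
  have sub: "{d. d dvd n} \<subseteq> {1..n}"
    using n by (auto simp: Suc_le_eq dvd_pos_nat intro: dvd_imp_le)
  have "divisor_sigma r n \<le> (\<Sum>d | d dvd n. n ^ r)"
    unfolding divisor_sigma_def using n by (intro sum_mono power_mono) (auto intro: dvd_imp_le)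
  also have "\<dots> \<le> n * n ^ r"
    using card_mono[OF _ sub] by simp
  finally show ?thesis by simp
qed

text \<open>The nome \<open>q = exp (2 * pi * \<i> * \<tau>)\<close> takes every value of the
  punctured unit disc, so the difference of two expansions is a power series vanishing there. Since
  \<open>q = 0\<close> is not attained, its constant coefficient is recovered as a limit before the
  isolation of zeros applies to the full disc.\<close>

lemma power_series_in_nome_unique:
  fixes a b :: "nat \<Rightarrow> complex"
  assumes a: "\<And>\<tau>. Im \<tau> > 0 \<Longrightarrow> (\<lambda>n. a n * exp (2 * of_real pi * \<i> * of_nat n * \<tau>)) sums f \<tau>"
    and b: "\<And>\<tau>. Im \<tau> > 0 \<Longrightarrow> (\<lambda>n. b n * exp (2 * of_real pi * \<i> * of_nat n * \<tau>)) sums f \<tau>"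
  shows "a = b"
proof -
  define d where "d = (\<lambda>n. a n - b n)"
  have sums: "(\<lambda>n. d n * q ^ n) sums 0" if q: "q \<noteq> 0" "norm q < 1" for q
  proof -
    define \<tau> where "\<tau> = Ln q / (2 * of_real pi * \<i>)"
    have "Im \<tau> = - Re (Ln q) / (2 * pi)"
      by (simp add: \<tau>_def Im_divide power2_eq_square)
    also have "\<dots> > 0" using q by (simp add: field_simps)
    finally have "Im \<tau> > 0" .
    have "exp (2 * of_real pi * \<i> * of_nat n * \<tau>) = q ^ n" for n
    proof -
      have eq: "2 * of_real pi * \<i> * of_nat n * \<tau> = of_nat n * Ln q"
        by (simp add: \<tau>_def)
      show ?thesis unfolding eq using q by (simp add: exp_of_nat_mult)
    qed
    with sums_diff[OF a[OF \<open>Im \<tau> > 0\<close>] b[OF \<open>Im \<tau> > 0\<close>]] show ?thesis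
      by (simp add: d_def left_diff_distrib)
  qed
  have "((\<lambda>_. 0) \<longlongrightarrow> d 0) (at (0 :: complex))"
    using sums by (intro powser_limit_0_strong[of 1]) auto
  hence d0: "d 0 = 0"
    using tendsto_unique[OF _ tendsto_const] by (metis trivial_limit_at)
  have "d n = 0" for n
  proof (rule ccontr)
    assume "d n \<noteq> 0"
    hence "n > 0" using d0 by (cases n) auto
    have "(\<lambda>n. d n * (x - 0) ^ n) sums 0" if "norm (x - 0) < 1" for x
      using sums[of x] that d0 powser_sums_zero[of d] by (cases "x = 0") auto
    then obtain s :: real where "0 < s" "\<And>z :: complex. z \<in> cball 0 s - {0} \<Longrightarrow> (0 :: complex) \<noteq> 0"
      using powser_0_nonzero[of 1 0 d "\<lambda>_. 0" n] \<open>d n \<noteq> 0\<close> \<open>n > 0\<close> zero_less_one by blast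
    from this(2)[of "of_real s"] \<open>0 < s\<close> show False by simp
  qed
  thus ?thesis by (auto simp: d_def fun_eq_iff)
qed

definition eisenstein_const :: "nat \<Rightarrow> real" where
  "eisenstein_const k = (2 * pi) ^ k / (zeta_nat k * Gamma (real k))"

lemma eisenstein_sums:
  assumes "Im \<tau> > 0"
  shows "(\<lambda>n. (if n = 0 then 1 else of_real (eisenstein_const k) * of_nat (divisor_sigma (k - 1) n)) *
    exp (2 * of_real pi * \<i> * of_nat n * \<tau>)) sums eisenstein_E k \<tau>"
proof -
  define q where "q = exp (2 * of_real pi * \<i> * \<tau>)"
  have q: "norm q < 1" using assms by (simp add: q_def)
  have q_pow: "exp (2 * of_real pi * \<i> * of_nat n * \<tau>) = q ^ n" for n
    unfolding q_def exp_of_nat_mult[symmetric] by (simp add: algebra_simps)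
  define u where "u = (\<lambda>n. of_nat (divisor_sigma (k - 1) (Suc n)) * q ^ Suc n)"
  have "summable u"
  proof (rule summable_comparison_test)
    show "summable (\<lambda>n. real (Suc n) ^ Suc (k - 1) * norm q ^ Suc n)"
      by (subst summable_Suc_iff) (rule summable_pow_mult_power, use q in simp)
    have "norm (u n) \<le> real (Suc n) ^ Suc (k - 1) * norm q ^ Suc n" for n
    proof -
      have "real (divisor_sigma (k - 1) (Suc n)) \<le> real (Suc n ^ Suc (k - 1))"
        using divisor_sigma_le[of "Suc n"] by (simp only: of_nat_le_iff zero_less_Suc)
      thus ?thesis
        unfolding u_def norm_mult norm_power norm_of_nat of_nat_power by (rule mult_right_mono) simp
    qed
    thus "\<exists>N. \<forall>n\<ge>N. norm (u n) \<le> real (Suc n) ^ Suc (k - 1) * norm q ^ Suc n" by blast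
  qed
  from sums_mult[OF summable_sums[OF this], of "of_real (eisenstein_const k)"]
  have "(\<lambda>n. of_real (eisenstein_const k) * u n) sums (of_real (eisenstein_const k) * suminf u)" .
  hence "(\<lambda>n. (if Suc n = 0 then 1 else of_real (eisenstein_const k) * of_nat (divisor_sigma (k - 1) (Suc n))) * q ^ Suc n)
      sums (of_real (eisenstein_const k) * suminf u)"
    by (simp add: u_def mult.assoc del: power_Suc)
  hence "(\<lambda>n. (if n = 0 then 1 else of_real (eisenstein_const k) * of_nat (divisor_sigma (k - 1) n)) * q ^ n)
      sums (of_real (eisenstein_const k) * suminf u + (if (0 :: nat) = 0 then 1 else of_real (eisenstein_const k) * of_nat (divisor_sigma (k - 1) 0)) * q ^ 0)"
    by (rule sums_Suc)
  moreover have "eisenstein_E k \<tau> = 1 + of_real (eisenstein_const k) * suminf u"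
    unfolding eisenstein_E_def q_pow u_def eisenstein_const_def ..
  ultimately show ?thesis
    unfolding q_pow by (simp add: add.commute)
qed

lemma fourier_coeff_eisenstein:
  "fourier_coeff (eisenstein_E k) n =
     (if n = 0 then 1 else of_real (eisenstein_const k) * of_nat (divisor_sigma (k - 1) n))"
proof -
  have "fourier_coeff (eisenstein_E k) =
     (\<lambda>n. if n = 0 then 1 else of_real (eisenstein_const k) * of_nat (divisor_sigma (k - 1) n))"
    unfolding fourier_coeff_def
  proof (rule the_equality)
    fix a assume a: "\<forall>\<tau>. Im \<tau> > 0 \<longrightarrow> (\<lambda>n. a n * exp (2 * of_real pi * \<i> * of_nat n * \<tau>)) sums eisenstein_E k \<tau>"
    show "a = (\<lambda>n. if n = 0 then 1 else of_real (eisenstein_const k) * of_nat (divisor_sigma (k - 1) n))"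
      by (rule power_series_in_nome_unique[of _ "eisenstein_E k"]) (use a eisenstein_sums in auto)
  qed (use eisenstein_sums in blast)
  thus ?thesis by simp
qed

text \<open>The divisor sum is the Dirichlet convolution of \<open>d ^ r\<close> with the constant
  1. Absolute convergence permits regrouping the product of the two zeta series by
  \<open>n = d * e\<close>.\<close>

lemma divisor_sigma_dirichlet_sums:
  fixes s :: complex and r :: nat
  assumes s: "Re s > real r + 1"
  shows "(\<lambda>n. of_nat (divisor_sigma r (Suc n)) * of_nat (Suc n) powr (-s)) sums
    (zeta_series (s - of_nat r) * zeta_series s)"
proof -
  define u where "u = (\<lambda>d. of_nat (Suc d) powr (-(s - of_nat r)) :: complex)"
  define v where "v = (\<lambda>e. of_nat (Suc e) powr (-s) :: complex)"
  have Re: "Re (s - of_nat r) > 1" "Re s > 1" using s by auto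
  have u: "(u has_sum zeta_series (s - of_nat r)) UNIV" and u_abs: "(\<lambda>d. norm (u d)) summable_on UNIV"
    using norm_summable_imp_has_sum[OF summable_norm_zeta_series[OF Re(1)] zeta_series_sums[OF Re(1)]]
      norm_summable_imp_summable_on[of "\<lambda>d. norm (u d)"] summable_norm_zeta_series[OF Re(1)]
    by (simp_all only: u_def real_norm_def abs_norm_cancel)
  have v: "(v has_sum zeta_series s) UNIV" and v_abs: "(\<lambda>e. norm (v e)) summable_on UNIV"
    using norm_summable_imp_has_sum[OF summable_norm_zeta_series[OF Re(2)] zeta_series_sums[OF Re(2)]]
      norm_summable_imp_summable_on[of "\<lambda>e. norm (v e)"] summable_norm_zeta_series[OF Re(2)]
    by (simp_all only: v_def real_norm_def abs_norm_cancel)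
  have "(\<lambda>x. norm (case x of (d, e) \<Rightarrow> u d * v e)) summable_on (UNIV \<times> UNIV)"
    unfolding Infinite_Sum.abs_summable_on_Sigma_iff
    using u_abs v_abs
    by (auto simp: norm_mult infsum_cmult_right' infsum_nonneg intro!: summable_on_cmult_right summable_on_cmult_left)
  hence "(\<lambda>(d, e). u d * v e) summable_on (UNIV \<times> UNIV)"
    by (rule abs_summable_summable)
  hence "((\<lambda>(d, e). u d * v e) has_sum (zeta_series (s - of_nat r) * zeta_series s)) (UNIV \<times> UNIV)"
    by (intro has_sum_SigmaI[where g = "\<lambda>d. u d * zeta_series s"])
       (auto intro!: has_sum_cmult_right has_sum_cmult_left u v)
  also have "?this \<longleftrightarrow> ((\<lambda>(n, d). of_nat (d ^ r) * of_nat (Suc n) powr (-s)) has_sum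
      (zeta_series (s - of_nat r) * zeta_series s)) (Sigma UNIV (\<lambda>n. {d. d dvd Suc n}))"
  \<comment> \<open>All indices stand for their successors, hence the product of two successors
    minus one. The divisor \<open>d\<close> itself is not shifted.\<close>
  proof (rule has_sum_reindex_bij_witness[of _ "\<lambda>(n, d). (d - 1, Suc n div d - 1)" "\<lambda>(a, b). (Suc a * Suc b - 1, Suc a)"])
    fix x :: "nat \<times> nat"
    obtain a b where x: "x = (a, b)" by (cases x)
    have "of_nat (Suc a ^ r) * (of_nat (Suc a) * of_nat (Suc b)) powr (-s) = u a * v b"
    proof -
      have "(of_nat (Suc a) * of_nat (Suc b)) powr (-s) = of_nat (Suc a) powr (-s) * (of_nat (Suc b) powr (-s) :: complex)"
        by (rule powr_times_real) (simp_all del: of_nat_Suc)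
      moreover have "u a = of_nat (Suc a) powr (-s) * of_nat (Suc a) ^ r"
        unfolding u_def by (simp add: powr_diff powr_minus powr_nat field_simps del: of_nat_Suc)
      ultimately show ?thesis by (simp add: v_def mult_ac del: of_nat_Suc)
    qed
    moreover have "of_nat (Suc (Suc a * Suc b - 1)) = (of_nat (Suc a) * of_nat (Suc b) :: complex)"
      by (simp del: of_nat_Suc add: of_nat_mult[symmetric])
    ultimately show "(case case x of (a, b) \<Rightarrow> (Suc a * Suc b - 1, Suc a) of (n, d) \<Rightarrow> of_nat (d ^ r) * of_nat (Suc n) powr (-s)) =
       (case x of (d, e) \<Rightarrow> u d * v e)"
      unfolding x prod.case by metis
    show "(case case x of (a, b) \<Rightarrow> (Suc a * Suc b - 1, Suc a) of (n, d) \<Rightarrow> (d - 1, Suc n div d - 1)) = x"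
      unfolding x prod.case by (simp del: mult_Suc mult_Suc_right)
    show "(case x of (a, b) \<Rightarrow> (Suc a * Suc b - 1, Suc a)) \<in> Sigma UNIV (\<lambda>n. {d. d dvd Suc n})"
      unfolding x prod.case by (simp del: mult_Suc mult_Suc_right)
  next
    fix y :: "nat \<times> nat" assume "y \<in> Sigma UNIV (\<lambda>n. {d. d dvd Suc n})"
    then obtain n d where y: "y = (n, d)" "d dvd Suc n" by auto
    then obtain e where e: "Suc n = d * e" by (auto elim: dvdE)
    hence "d > 0" "e > 0" by (metis mult_0 mult_0_right neq0_conv nat.distinct(1))+
    thus "(case case y of (n, d) \<Rightarrow> (d - 1, Suc n div d - 1) of (a, b) \<Rightarrow> (Suc a * Suc b - 1, Suc a)) = y"
      using e by (simp add: y(1) del: mult_Suc mult_Suc_right)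
  qed auto
  finally have "((\<lambda>n. \<Sum>d | d dvd Suc n. of_nat (d ^ r) * of_nat (Suc n) powr (-s)) has_sum
      (zeta_series (s - of_nat r) * zeta_series s)) UNIV"
    by (rule has_sum_SigmaD) (auto intro!: has_sum_finite)
  hence "(\<lambda>n. \<Sum>d | d dvd Suc n. of_nat (d ^ r) * of_nat (Suc n) powr (-s)) sums
      (zeta_series (s - of_nat r) * zeta_series s)"
    by (rule has_sum_imp_sums)
  thus ?thesis
    unfolding divisor_sigma_def of_nat_sum sum_distrib_right .
qed

lemma L_series_eisenstein:
  assumes "Re s > real k" "k > 0"
  shows "L_series (eisenstein_E k) s =
    of_real (eisenstein_const k) * (zeta_series (s - of_nat k + 1) * zeta_series s)"
proof -
  have eq: "s - of_nat (k - 1) = s - of_nat k + 1" using assms by (simp add: of_nat_diff)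
  have "Re s > real (k - 1) + 1" using assms by (simp add: of_nat_diff)
  from sums_mult[OF divisor_sigma_dirichlet_sums[OF this], of "of_real (eisenstein_const k)"]
  show ?thesis
    unfolding L_series_def fourier_coeff_eisenstein eq by (simp add: sums_iff mult.assoc del: of_nat_Suc)
qed

section \<open>Uniqueness of meromorphic continuation\<close>

lemma nicely_meromorphic_eqI:
  assumes f: "f nicely_meromorphic_on {z}" and g: "g nicely_meromorphic_on {z}"
    and eq: "eventually (\<lambda>w. f w = g w) (at z)"
  shows "f z = g z"
proof (cases "is_pole f z")
  case True
  hence "is_pole g z"
    using eq is_pole_cong[OF _ refl] by blast
  with True f g have "\<not> f \<midarrow>z\<rightarrow> f z" "\<not> g \<midarrow>z\<rightarrow> g z"
    unfolding is_pole_def using not_tendsto_and_filterlim_at_infinity[of "at z"] by auto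
  thus ?thesis using f g by (auto simp: nicely_meromorphic_on_def)
next
  case False
  hence "\<not> is_pole g z"
    using eq is_pole_cong[OF _ refl] by blast
  with False f g have "f \<midarrow>z\<rightarrow> f z" "g \<midarrow>z\<rightarrow> g z"
    by (auto simp: nicely_meromorphic_on_def)
  moreover from this(1) eq have "g \<midarrow>z\<rightarrow> f z"
    by (rule Lim_transform_eventually)
  ultimately show ?thesis using LIM_unique by blast
qed

text \<open>The difference of two continuations vanishes on the smaller of the two half-planes, so
  after removal of singularities it is zero everywhere. This gives equality on punctured
  neighbourhoods; the normalised values of nicely meromorphic functions settle the points
  themselves.\<close>

lemma meromorphic_continuation_eqI:
  assumes G: "G nicely_meromorphic_on UNIV" and GF: "\<And>s. Re s > c \<Longrightarrow> G s = F s"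
  shows "meromorphic_continuation F = G"
  unfolding meromorphic_continuation_def
proof (rule the_equality)
  fix H assume H: "H nicely_meromorphic_on UNIV \<and> (\<exists>c::real. \<forall>s. Re s > c \<longrightarrow> H s = F s)"
  then obtain c' where HF: "\<And>s. Re s > c' \<Longrightarrow> H s = F s" by blast
  define d where "d = (\<lambda>s. H s - G s)"
  define b where "b = max c c'"
  have mero: "d meromorphic_on UNIV"
    using G H unfolding d_def nicely_meromorphic_on_def by (intro meromorphic_intros) auto
  have zero: "remove_sings d z = 0" if "Re z > b" for z
  proof (rule remove_sings_eqI, rule tendsto_eventually)
    show "eventually (\<lambda>w. d w = 0) (at z)"
      using eventually_at_in_open'[OF open_halfspace_Re_gt, of z b] that
      by (auto elim!: eventually_mono simp: d_def b_def GF HF)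
  qed
  have "eventually (\<lambda>w. remove_sings d w = 0) (at (of_real (b + 1)))"
    using eventually_at_in_open'[OF open_halfspace_Re_gt, of "of_real (b + 1)" b]
    by (auto elim!: eventually_mono intro: zero)
  hence "frequently (\<lambda>w. remove_sings d w = 0) (at (of_real (b + 1)))"
    by (intro eventually_frequently) auto
  from frequently_eq_meromorphic_imp_constant[OF this remove_sings_nicely_meromorphic[OF mero]]
  have const: "remove_sings d w = 0" for w by (simp add: connected_UNIV)
  show "H = G"
  proof
    fix z
    have "isolated_singularity_at d z"
      using mero by (meson UNIV_I meromorphic_on_altdef)
    hence "eventually (\<lambda>w. remove_sings d w = d w) (at z)"
      by (rule eventually_remove_sings_eq_at)
    hence "eventually (\<lambda>w. H w = G w) (at z)"
      by eventually_elim (use const in \<open>simp add: d_def\<close>)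
    thus "H z = G z"
      using G H by (intro nicely_meromorphic_eqI) (auto intro: nicely_meromorphic_on_subset)
  qed
qed (use G GF in blast)

lemma eventually_sin_nonzero: "eventually (\<lambda>w :: complex. sin (of_real pi * w / 2) \<noteq> 0) (at z)"
proof (rule ccontr)
  assume "\<not> eventually (\<lambda>w :: complex. sin (of_real pi * w / 2) \<noteq> 0) (at z)"
  hence limpt: "z islimpt {w. sin (of_real pi * w / 2) = 0}"
    by (simp add: islimpt_conv_frequently_at frequently_def)
  have "sin (of_real pi * 1 / 2 :: complex) = 0"
  proof (rule analytic_continuation[where f = "\<lambda>w. sin (of_real pi * w / 2)" and S = UNIV and w = 1, OF _ _ _ _ _ limpt])
    show "(\<lambda>w. sin (of_real pi * w / 2) :: complex) holomorphic_on UNIV"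
      by (intro holomorphic_intros) simp
  qed (simp_all add: connected_UNIV)
  moreover have eq: "of_real pi * 1 / 2 = complex_of_real (pi / 2)" by simp
  ultimately show False unfolding eq sin_of_real by simp
qed

definition Lambda_strip :: "nat \<Rightarrow> complex \<Rightarrow> complex" where
  "Lambda_strip k s = (Gamma s * Gamma (of_nat k - s)) * (zeta_series s * zeta_series (of_nat k - s))"

text \<open>The power is \<open>(2 * pi) powr (-s)\<close> times
  \<open>(2 * pi) powr (s - k + 1)\<close>, free of \<open>s\<close>; the division by
  \<open>pi\<close> comes from the reflection formula for Gamma.\<close>

definition Lambda_const :: "nat \<Rightarrow> complex" where
  "Lambda_const k = of_real (eisenstein_const k) * of_real (2 * pi) powr (1 - of_nat k) / of_real pi"

text \<open>With \<open>w = s - k + 1\<close>, the product \<open>Gamma_zeta w * rGamma w\<close> is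
  \<open>\<zeta>(w)\<close>, and \<open>Re w < 0\<close> in the strip. The reflected formula divides
  by \<open>cos (pi * w / 2) = - sin (pi * s / 2)\<close>, while Gamma reflection contributes
  \<open>sin (pi * (k - s))\<close>. Their quotient is \<open>2 * cos (pi * s / 2)\<close>, the
  factor that \<open>completed_L_tilde\<close> divides out.\<close>

lemma Gamma_zeta_functional_equation:
  assumes k: "4 dvd k" and s: "1 < Re s" "Re s < real k - 1" and nz: "sin (of_real pi * s / 2) \<noteq> 0"
  shows "of_real (2 * pi) powr (-s) * (Gamma_zeta s * (Gamma_zeta (s - of_nat k + 1) * rGamma (s - of_nat k + 1))) =
    of_real (2 * pi) powr (1 - of_nat k) / of_real pi * (Lambda_strip k s * cos (of_real pi * s / 2))"
proof -
  obtain q where q: "k = 4 * q" using k by (auto elim: dvdE)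
  define w where "w = s - of_nat k + 1"
  \<comment> \<open>This is \<open>pi * k / 2\<close>, a multiple of \<open>2 * pi\<close> because 4
    divides \<open>k\<close>; the sign of the functional equation depends on it.\<close>
  define A where "A = complex_of_real (2 * real q * pi)"
  define x where "x = of_real pi * s / 2"
  have A: "cos A = 1" "sin A = 0"
    unfolding A_def cos_of_real sin_of_real by (simp_all only: cos_2npi sin_2npi of_real_1 of_real_0)
  have w_eq: "of_real pi * w / 2 = x + of_real pi / 2 - A"
    by (simp add: w_def x_def A_def q field_simps)
  have cos_w: "cos (of_real pi * w / 2) = - sin x"
    unfolding w_eq cos_diff A cos_add by simp
  have k_eq: "of_real pi * (of_nat k - s) = (A + A) - (x + x)"
    by (simp add: x_def A_def q field_simps)
  have sin_k: "sin (of_real pi * (of_nat k - s)) = - 2 * sin x * cos x"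
    unfolding k_eq sin_diff sin_add cos_add A by simp
  have not_int: "of_nat k - s \<notin> \<int>\<^sub>\<le>\<^sub>0"
    using s by (auto elim!: nonpos_Ints_cases dest!: arg_cong[of _ _ Re])
  hence Gamma_nz: "rGamma (of_nat k - s) \<noteq> 0" by (simp add: rGamma_eq_zero_iff)
  have w1: "1 - w = of_nat k - s" by (simp add: w_def)
  have "rGamma (of_nat k - s) * rGamma w = sin (of_real pi * (of_nat k - s)) / of_real pi"
    using rGamma_reflection_complex[of "of_nat k - s"] by (simp add: w_def algebra_simps)
  hence rG: "rGamma w = Gamma (of_nat k - s) * (- 2 * sin x * cos x) / of_real pi"
    unfolding sin_k using Gamma_nz by (simp add: Gamma_def field_simps)
  have "Re w < 0" using s by (simp add: w_def)
  hence Gw: "Gamma_zeta w = of_real (2 * pi) powr w * zeta_series (of_nat k - s) / (2 * (- sin x))"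
    by (simp add: Gamma_zeta_left Gamma_zeta_left_def w1 cos_w)
  have pw: "of_real (2 * pi) powr (-s) * of_real (2 * pi) powr w = complex_of_real (2 * pi) powr (1 - of_nat k)"
    by (simp add: w_def powr_add[symmetric] algebra_simps)
  have "of_real (2 * pi) powr (-s) * (Gamma_zeta s * (Gamma_zeta w * rGamma w)) =
      (of_real (2 * pi) powr (-s) * of_real (2 * pi) powr w) / of_real pi *
      ((Gamma s * Gamma (of_nat k - s)) * (zeta_series s * zeta_series (of_nat k - s)) * cos x)"
    using nz unfolding Gw rG Gamma_zeta_right[OF s(1)] x_def[symmetric] by (simp add: field_simps)
  thus ?thesis
    unfolding pw by (simp only: w_def x_def Lambda_strip_def)
qed

lemma analytic_Lambda_strip:
  assumes "1 < Re s" "Re s < real k - 1"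
  shows "Lambda_strip k analytic_on {s}"
proof -
  have S: "{s. 1 < Re s \<and> Re s < real k - 1} = {s. Re s > 1} \<inter> {s. Re s < real k - 1}" by auto
  have "open {s. 1 < Re s \<and> Re s < real k - 1}"
    unfolding S by (intro open_Int open_halfspace_Re_gt open_halfspace_Re_lt)
  moreover have "s \<notin> \<int>\<^sub>\<le>\<^sub>0" "of_nat k - s \<notin> \<int>\<^sub>\<le>\<^sub>0" if "1 < Re s" "Re s < real k - 1" for s
    using that by (auto elim!: nonpos_Ints_cases dest!: arg_cong[of _ _ Re])
  hence "Lambda_strip k holomorphic_on {s. 1 < Re s \<and> Re s < real k - 1}"
    unfolding Lambda_strip_def[abs_def] by (intro holomorphic_intros) auto
  ultimately show ?thesis
    using assms by (auto simp: analytic_at)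
qed

lemma completed_L_eisenstein:
  assumes k: "4 dvd k" "k > 0" and s: "1 < Re s" "Re s < real k - 1"
  shows "completed_L (eisenstein_E k) s = Lambda_const k * Lambda_strip k s * cos (of_real pi * s / 2)"
proof -
  \<comment> \<open>The factor \<open>\<zeta>(s - k + 1)\<close> is written as
    \<open>Gamma_zeta\<close> times the entire function \<open>rGamma\<close>, so that meromorphy is
    immediate.\<close>
  define G where "G = (\<lambda>s. of_real (eisenstein_const k) *
    (of_real (2 * pi) powr (-s) * (Gamma_zeta s * (Gamma_zeta (s - of_nat k + 1) * rGamma (s - of_nat k + 1)))))"
  have twopi: "complex_of_real (2 * pi) \<notin> \<real>\<^sub>\<le>\<^sub>0"
    using pi_gt_zero unfolding complex_nonpos_Reals_iff Re_complex_of_real by linarith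
  have "(\<lambda>s. Gamma_zeta (s - of_nat k + 1)) meromorphic_on UNIV"
    by (rule meromorphic_on_compose[OF meromorphic_Gamma_zeta]) (auto intro!: analytic_intros)
  hence mero: "G meromorphic_on UNIV"
    unfolding G_def using twopi
    by (intro meromorphic_on_mult meromorphic_Gamma_zeta meromorphic_on_const)
       (auto intro!: analytic_on_imp_meromorphic_on analytic_intros simp del: of_real_mult)
  have "meromorphic_continuation (\<lambda>s. of_real (2 * pi) powr (-s) * Gamma s * L_series (eisenstein_E k) s) = remove_sings G"
  proof (rule meromorphic_continuation_eqI)
    show "remove_sings G nicely_meromorphic_on UNIV"
      by (rule remove_sings_nicely_meromorphic[OF mero])
    fix s :: complex assume s: "Re s > real k"
    define F where "F = (\<lambda>s. of_real (2 * pi) powr (-s) * Gamma s *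
      (of_real (eisenstein_const k) * (zeta_series (s - of_nat k + 1) * zeta_series s)))"
    have k1: "real k \<ge> 1" using k by simp
    have not_int: "z \<notin> \<int>\<^sub>\<le>\<^sub>0" "z - of_nat k + 1 \<notin> \<int>\<^sub>\<le>\<^sub>0" if "Re z > real k" for z
      using that by (auto elim!: nonpos_Ints_cases dest!: arg_cong[of _ _ Re])
    have GF: "G z = F z" if "Re z > real k" for z
    proof -
      have "Re (z - of_nat k + 1) > 1" "Re z > 1" using that k1 by auto
      moreover have "Gamma (z - of_nat k + 1) * rGamma (z - of_nat k + 1) = 1"
        using not_int(2)[OF that] by (simp add: Gamma_def rGamma_eq_zero_iff)
      ultimately show ?thesis
        by (simp add: G_def F_def Gamma_zeta_right mult_ac)
    qed
    have "F holomorphic_on {z. Re z > real k}"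
      unfolding F_def using not_int k1 twopi by (intro holomorphic_intros) (auto simp del: of_real_mult)
    hence "F \<midarrow>s\<rightarrow> F s"
      unfolding isCont_def[symmetric]
      using s open_halfspace_Re_gt holomorphic_on_imp_continuous_on continuous_on_eq_continuous_at by blast
    moreover have "eventually (\<lambda>z. F z = G z) (at s)"
      using eventually_at_in_open'[OF open_halfspace_Re_gt, of s "real k"] s
      by (auto elim!: eventually_mono simp: GF)
    ultimately have "G \<midarrow>s\<rightarrow> F s"
      by (rule Lim_transform_eventually)
    hence "remove_sings G s = F s" by (rule remove_sings_eqI)
    thus "remove_sings G s = of_real (2 * pi) powr (-s) * Gamma s * L_series (eisenstein_E k) s"
      using L_series_eisenstein[OF s k(2)] by (simp add: F_def)
  qed
  hence "completed_L (eisenstein_E k) s = remove_sings G s"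
    by (simp only: completed_L_def)
  also have "\<dots> = Lambda_const k * Lambda_strip k s * cos (of_real pi * s / 2)"
  proof (rule remove_sings_eqI)
    let ?H = "\<lambda>s. Lambda_const k * Lambda_strip k s * cos (of_real pi * s / 2)"
    have "eventually (\<lambda>z. z \<in> {s. 1 < Re s}) (at s)"
      by (rule eventually_at_in_open'[OF open_halfspace_Re_gt]) (simp add: s)
    moreover have "eventually (\<lambda>z. z \<in> {s. Re s < real k - 1}) (at s)"
      by (rule eventually_at_in_open'[OF open_halfspace_Re_lt]) (simp add: s)
    \<comment> \<open>The sine vanishes at the even integers, exactly where the coefficients are
      taken. The identity is therefore used on a punctured neighbourhood and its value at
      \<open>s\<close> obtained as a limit.\<close>
    ultimately have "eventually (\<lambda>z. ?H z = G z) (at s)"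
      using eventually_sin_nonzero[of s]
    proof eventually_elim
      case (elim z)
      hence z: "1 < Re z" "Re z < real k - 1" "sin (of_real pi * z / 2) \<noteq> 0" by simp_all
      show ?case
        unfolding G_def Gamma_zeta_functional_equation[OF k(1) z] Lambda_const_def
        by (simp add: mult_ac)
    qed
    moreover have "isCont ?H s"
      using analytic_at_imp_isCont[OF analytic_Lambda_strip[OF s]] by (intro continuous_intros) simp_all
    hence "?H \<midarrow>s\<rightarrow> ?H s" by (simp only: isCont_def)
    ultimately show "G \<midarrow>s\<rightarrow> ?H s"
      by (rule Lim_transform_eventually[rotated])
  qed
  finally show ?thesis .
qed

text \<open>At the even integer \<open>n + 1\<close> the cosine is 1 or -1, so it can be cancelled
  in a whole neighbourhood, which is what equality of derivatives requires.\<close>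

lemma higher_deriv_completed_L_tilde:
  assumes k: "4 dvd k" "k > 0" and n: "odd n" "1 \<le> n" "n + 3 \<le> k"
  shows "(deriv ^^ m) (completed_L_tilde (eisenstein_E k)) (of_nat (n + 1)) =
    Lambda_const k * (deriv ^^ m) (Lambda_strip k) (of_nat (n + 1))"
proof -
  define s where "s = complex_of_nat (n + 1)"
  have s: "1 < Re s" "Re s < real k - 1" using n by (auto simp: s_def)
  obtain j where j: "n + 1 = 2 * j" using n by (metis dvdE odd_even_add odd_one)
  have s_eq: "of_real pi * s / 2 = of_real (real j * pi)"
    unfolding s_def j by simp
  have "cos (of_real pi * s / 2) \<noteq> 0"
    unfolding s_eq cos_of_real by simp
  moreover have "isCont (\<lambda>s. cos (of_real pi * s / 2) :: complex) s"
    by (intro continuous_intros) simp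
  ultimately have "eventually (\<lambda>z. cos (of_real pi * z / 2) \<noteq> 0) (nhds s)"
    by (simp add: isCont_def tendsto_imp_eventually_ne eventually_nhds_conv_at)
  moreover have "eventually (\<lambda>z. z \<in> {s. 1 < Re s}) (nhds s)"
    by (rule eventually_nhds_in_open[OF open_halfspace_Re_gt]) (simp add: s)
  moreover have "eventually (\<lambda>z. z \<in> {s. Re s < real k - 1}) (nhds s)"
    by (rule eventually_nhds_in_open[OF open_halfspace_Re_lt]) (simp add: s)
  ultimately have "eventually (\<lambda>z. completed_L_tilde (eisenstein_E k) z = Lambda_const k * Lambda_strip k z) (nhds s)"
    by eventually_elim (simp add: completed_L_tilde_def completed_L_eisenstein[OF k])
  hence "(deriv ^^ m) (completed_L_tilde (eisenstein_E k)) s = (deriv ^^ m) (\<lambda>z. Lambda_const k * Lambda_strip k z) s"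
    by (rule higher_deriv_cong_ev) simp
  also have "\<dots> = Lambda_const k * (deriv ^^ m) (Lambda_strip k) s"
    by (rule higher_deriv_cmult'[OF analytic_Lambda_strip[OF s]])
  finally show ?thesis by (simp only: s_def)
qed

lemma Lambda_const_nonzero:
  assumes "k \<ge> 2"
  shows "Lambda_const k \<noteq> 0"
proof -
  have "summable (\<lambda>n. 1 / real (Suc n) ^ k)"
    using inverse_power_summable[of k, where ?'a = real] assms
    by (subst summable_Suc_iff) (simp add: divide_inverse)
  hence "zeta_nat k > 0"
    unfolding zeta_nat_def by (rule suminf_pos) simp
  moreover have "Gamma (real k) > 0" using assms by (intro Gamma_real_pos) auto
  ultimately have "eisenstein_const k \<noteq> 0" by (simp add: eisenstein_const_def)
  thus ?thesis by (simp add: Lambda_const_def)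
qed

section \<open>Zeros of the period polynomial\<close>

lemma abs_monotone_at_subset: "abs_monotone_at c r f \<Longrightarrow> r' \<le> r \<Longrightarrow> abs_monotone_at c r' f"
  unfolding abs_monotone_at_def using holomorphic_on_subset subset_ball by blast

text \<open>The quotient of the \<open>m\<close>-th derivative of \<open>\<Gamma>(s) \<Gamma>(k - s) \<zeta>(s) \<zeta>(k - s)\<close> by the Gamma factors.\<close>

definition Lambda_quotient :: "nat \<Rightarrow> nat \<Rightarrow> complex \<Rightarrow> complex" where
  "Lambda_quotient k m = twisted_deriv (\<lambda>s. Digamma s - Digamma (of_real (real k) - s))
     (\<lambda>s. zeta_series s * zeta_series (of_real (real k) - s)) m"

context
  fixes k :: nat
  assumes k: "k \<ge> 4"
begin

lemma Digamma_diff_abs_monotone: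
  "abs_monotone_at (of_real (real k / 2)) (real k / 2 - 1) (\<lambda>s. Digamma s - Digamma (of_real (real k) - s))"
  using k by (intro abs_monotone_at_subset[OF abs_monotone_at_Digamma_difference]) auto

lemma zeta_product_abs_monotone:
  "abs_monotone_at (of_real (real k / 2)) (real k / 2 - 1) (\<lambda>s. zeta_series s * zeta_series (of_real (real k) - s))"
  using k by (intro abs_monotone_at_zeta_series_product) auto

lemma Lambda_quotient_abs_monotone:
  "abs_monotone_at (of_real (real k / 2)) (real k / 2 - 1) (Lambda_quotient k m)"
  unfolding Lambda_quotient_def
  by (rule abs_monotone_at_twisted_deriv[OF Digamma_diff_abs_monotone zeta_product_abs_monotone]) (use k in auto)

lemma Re_in_ball:
  assumes "s \<in> ball (of_real (real k / 2)) (real k / 2 - 1)"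
  shows "1 < Re s" "Re s < real k - 1"
  using assms abs_Re_le_cmod[of "of_real (real k / 2) - s"] by (auto simp: dist_norm)

lemma higher_deriv_Lambda_strip:
  assumes s: "s \<in> ball (of_real (real k / 2)) (real k / 2 - 1)"
  shows "(deriv ^^ m) (Lambda_strip k) s = Gamma s * Gamma (of_nat k - s) * Lambda_quotient k m s"
proof -
  have "(deriv ^^ m) (\<lambda>s. (Gamma s * Gamma (of_real (real k) - s)) * (zeta_series s * zeta_series (of_real (real k) - s))) s =
    (Gamma s * Gamma (of_real (real k) - s)) * Lambda_quotient k m s"
    unfolding Lambda_quotient_def
  proof (rule higher_deriv_mult_eq_twisted_deriv[OF _ _ open_ball s])
    fix s assume s: "s \<in> ball (complex_of_real (real k / 2)) (real k / 2 - 1)"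
    have "s \<notin> \<int>\<^sub>\<le>\<^sub>0" "of_real (real k) - s \<notin> \<int>\<^sub>\<le>\<^sub>0"
      using Re_in_ball[OF s] by (auto elim!: nonpos_Ints_cases dest!: arg_cong[of _ _ Re])
    thus "((\<lambda>s. Gamma s * Gamma (of_real (real k) - s)) has_field_derivative
        (Digamma s - Digamma (of_real (real k) - s)) * (Gamma s * Gamma (of_real (real k) - s))) (at s)"
      by (auto intro!: derivative_eq_intros simp: algebra_simps)
  qed (use Digamma_diff_abs_monotone zeta_product_abs_monotone in \<open>simp_all add: abs_monotone_at_def\<close>)
  thus ?thesis by (simp add: Lambda_strip_def[abs_def])
qed

lemma Lambda_quotient_reflect:
  assumes s: "s \<in> ball (of_real (real k / 2)) (real k / 2 - 1)"
  shows "Lambda_quotient k m (of_real (real k) - s) = (-1) ^ m * Lambda_quotient k m s"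
  unfolding Lambda_quotient_def
proof (rule twisted_deriv_reflect[OF _ _ open_ball s])
  fix s assume s: "s \<in> ball (complex_of_real (real k / 2)) (real k / 2 - 1)"
  have "of_real (real k / 2) - (of_real (real k) - s) = - (of_real (real k / 2) - s)"
    by (simp add: field_simps)
  hence "dist (of_real (real k / 2)) (of_real (real k) - s) = dist (of_real (real k / 2)) s"
    unfolding dist_norm by (metis norm_minus_cancel)
  with s show "of_real (real k) - s \<in> ball (of_real (real k / 2)) (real k / 2 - 1)" by simp
qed (use Digamma_diff_abs_monotone zeta_product_abs_monotone in \<open>simp_all add: abs_monotone_at_def mult.commute\<close>)

lemma Lambda_quotient_pos:
  assumes "0 < x" "x < real k / 2 - 1"
  shows "Re (Lambda_quotient k m (of_real (real k / 2) + of_real x)) > 0"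
  unfolding Lambda_quotient_def
proof (rule twisted_deriv_pos[OF Digamma_diff_abs_monotone zeta_product_abs_monotone assms])
  have eq: "of_real (real k / 2) + of_real x = complex_of_real (real k / 2 + x)"
    "of_real (real k) - complex_of_real (real k / 2 + x) = of_real (real k / 2 - x)"
    by (simp_all add: field_simps)
  have "Digamma (real k / 2 - x) < Digamma (real k / 2 + x)"
    using assms by (intro Digamma_real_strict_mono) auto
  thus "Re (Digamma (of_real (real k / 2) + of_real x) -
      Digamma (of_real (real k) - (of_real (real k / 2) + of_real x))) > 0"
    unfolding eq using assms by (subst (1 2) Polygamma_of_real) auto
  show "Re (zeta_series (of_real (real k / 2) + of_real x) *
      zeta_series (of_real (real k) - (of_real (real k / 2) + of_real x))) > 0"
    unfolding eq using assms zeta_series_of_real[of "real k / 2 + x"] zeta_series_of_real[of "real k / 2 - x"]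
    by simp
qed

text \<open>This serves the weight \<open>k = 4\<close>, whose only coefficient sits at the
  centre.\<close>

lemma Lambda_quotient_even_pos:
  assumes "even m"
  shows "Re (Lambda_quotient k m (of_real (real k / 2))) > 0"
  unfolding Lambda_quotient_def
proof (rule twisted_deriv_even_pos[OF Digamma_diff_abs_monotone zeta_product_abs_monotone _ _ _ assms])
  define c where "c = complex_of_real (real k / 2)"
  have eq: "of_real (real k) - c = c" by (simp add: c_def)
  have not_int: "c \<notin> \<int>\<^sub>\<le>\<^sub>0" "real k / 2 \<notin> \<int>\<^sub>\<le>\<^sub>0"
    using k by (auto simp: c_def elim!: nonpos_Ints_cases dest!: arg_cong[of _ _ Re])
  have "((\<lambda>s. Digamma s - Digamma (of_real (real k) - s)) has_field_derivative
      Polygamma (Suc 0) c - Polygamma (Suc 0) (of_real (real k) - c) * (0 - 1)) (at c)"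
    using not_int eq
    by (intro DERIV_diff has_field_derivative_Polygamma DERIV_chain2[OF has_field_derivative_Polygamma]
        DERIV_const DERIV_ident) simp_all
  hence "deriv (\<lambda>s. Digamma s - Digamma (of_real (real k) - s)) c = 2 * Polygamma (Suc 0) c"
    unfolding eq by (auto dest!: DERIV_imp_deriv)
  also have "Polygamma (Suc 0) c = of_real (Polygamma (Suc 0) (real k / 2))"
    unfolding c_def using k by (intro Polygamma_of_real) auto
  finally show "Re (deriv (\<lambda>s. Digamma s - Digamma (of_real (real k) - s)) (of_real (real k / 2))) > 0"
    using Polygamma_real_odd_pos[OF not_int(2), of "Suc 0"] by (simp add: c_def)
  have "zeta_series c = of_real (\<Sum>n. real (Suc n) powr - (real k / 2))" "Re (zeta_series c) > 0"
    unfolding c_def using k by (intro zeta_series_of_real; simp)+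
  hence "Re (zeta_series c * zeta_series (of_real (real k) - c)) > 0"
    unfolding eq by simp
  thus "Re (zeta_series (of_real (real k / 2)) * zeta_series (of_real (real k) - of_real (real k / 2))) > 0"
    by (simp only: c_def)
qed (use k in simp)

end

text \<open>Here \<open>n = 2 * l + 1\<close>. The binomial coefficient cancels the Gamma factors up
  to \<open>fact (k - 2)\<close>. The power of the imaginary unit is \<open>(-1) ^ l\<close>, and
  passing from \<open>z ^ 2\<close> to \<open>- (z ^ 2)\<close> costs the same sign since
  \<open>2 * N\<close> is even, so no signs survive.\<close>

lemma period_poly_deriv_eisenstein:
  assumes k: "k = 4 * N + 4"
  shows "period_poly_deriv (eisenstein_E k) k m z =
    Lambda_const k * fact (k - 2) * (\<Sum>l\<le>2 * N. Lambda_quotient k m (of_nat (2 * l + 2)) * (- (z ^ 2)) ^ (2 * N - l))"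
proof -
  have kh: "real k / 2 = 2 * real N + 2" by (simp add: k)
  have "period_poly_deriv (eisenstein_E k) k m z = (\<Sum>l\<le>2 * N. of_nat ((k - 2) choose (2 * l + 1)) *
      \<i> powi (1 - int (2 * l + 1)) * (deriv ^^ m) (completed_L_tilde (eisenstein_E k)) (of_nat (2 * l + 1 + 1)) *
      z ^ (k - 3 - (2 * l + 1)))"
    unfolding period_poly_deriv_def
    by (rule sum.reindex_bij_witness[of _ "\<lambda>l. 2 * l + 1" "\<lambda>n. n div 2"]) (auto simp: k elim!: oddE)
  also have "\<dots> = (\<Sum>l\<le>2 * N. Lambda_const k * fact (k - 2) *
      (Lambda_quotient k m (of_nat (2 * l + 2)) * (- (z ^ 2)) ^ (2 * N - l)))"
  proof (rule sum.cong[OF refl])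
    fix l assume "l \<in> {..2 * N}"
    hence l: "l \<le> 2 * N" by simp
    define s where "s = complex_of_nat (2 * l + 2)"
    have "s - of_real (real k / 2) = of_real (2 * real l - 2 * real N)"
      unfolding kh by (simp add: s_def)
    \<comment> \<open>The distance to the centre is at most \<open>2 * N\<close>, and the radius is
      \<open>2 * N + 1\<close>.\<close>
    moreover have "\<bar>2 * real l - 2 * real N\<bar> < real k / 2 - 1"
      using l unfolding kh by (auto simp: abs_if)
    ultimately have ball: "s \<in> ball (of_real (real k / 2)) (real k / 2 - 1)"
      unfolding mem_ball dist_norm norm_minus_commute[of "of_real (real k / 2)" s]
      by (simp only: norm_of_real)
    have "Gamma s = fact (2 * l + 1)"
      using Gamma_fact[of "2 * l + 1", where ?'a = complex] by (simp add: s_def add.commute)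
    moreover have "Gamma (of_nat k - s) = fact (k - 2 - (2 * l + 1))"
    proof -
      have "of_nat k - s = 1 + of_nat (k - 2 - (2 * l + 1))"
        using l by (simp add: s_def k of_nat_diff)
      thus ?thesis by (simp only: Gamma_fact)
    qed
    moreover have "of_nat ((k - 2) choose (2 * l + 1)) * (fact (2 * l + 1) * fact (k - 2 - (2 * l + 1))) = (fact (k - 2) :: complex)"
    proof -
      have "2 * l + 1 \<le> k - 2" using l by (simp add: k)
      from arg_cong[OF binomial_fact_lemma[OF this], of complex_of_nat] show ?thesis
        unfolding of_nat_mult of_nat_fact by (simp only: mult_ac)
    qed
    ultimately have bin: "of_nat ((k - 2) choose (2 * l + 1)) * (Gamma s * Gamma (of_nat k - s)) = (fact (k - 2) :: complex)"
      by simp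
    have "\<i> powi (1 - int (2 * l + 1)) = (-1) ^ l"
    proof -
      have eq: "1 - int (2 * l + 1) = - int (2 * l)" by simp
      show ?thesis
        unfolding eq power_int_minus power_int_of_nat by (simp add: power_mult flip: power_inverse)
    qed
    moreover have "z ^ (k - 3 - (2 * l + 1)) = (-1) ^ l * (- (z ^ 2)) ^ (2 * N - l)"
    proof -
      have "k - 3 - (2 * l + 1) = 2 * (2 * N - l)" by (simp add: k)
      moreover have "(-1) ^ l * (- (z ^ 2)) ^ (2 * N - l) = (-1) ^ l * (-1) ^ (2 * N - l) * (z ^ 2) ^ (2 * N - l)"
        by (subst power_minus) simp
      moreover have "(-1) ^ l * (-1) ^ (2 * N - l) = (1 :: complex)"
        using l by (simp flip: power_add)
      ultimately show ?thesis by (simp add: power_mult)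
    qed
    moreover have "(deriv ^^ m) (completed_L_tilde (eisenstein_E k)) (of_nat (2 * l + 1 + 1)) =
        Lambda_const k * (Gamma s * Gamma (of_nat k - s) * Lambda_quotient k m s)"
    proof -
      have "2 * l + 1 + 1 = 2 * l + 2" by simp
      thus ?thesis
        using higher_deriv_completed_L_tilde[of k "2 * l + 1" m] higher_deriv_Lambda_strip[OF _ ball, of m] l
        by (simp add: k s_def)
    qed
    ultimately have "of_nat ((k - 2) choose (2 * l + 1)) *
      \<i> powi (1 - int (2 * l + 1)) * (deriv ^^ m) (completed_L_tilde (eisenstein_E k)) (of_nat (2 * l + 1 + 1)) *
      z ^ (k - 3 - (2 * l + 1)) =
      Lambda_const k * (of_nat ((k - 2) choose (2 * l + 1)) * (Gamma s * Gamma (of_nat k - s))) *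
      (((-1) ^ l * (-1) ^ l) * Lambda_quotient k m s * (- (z ^ 2)) ^ (2 * N - l))"
      by (simp only: mult_ac)
    also have "(-1) ^ l * (-1) ^ l = (1 :: complex)"
      by (simp flip: power_mult_distrib)
    finally show "of_nat ((k - 2) choose (2 * l + 1)) *
      \<i> powi (1 - int (2 * l + 1)) * (deriv ^^ m) (completed_L_tilde (eisenstein_E k)) (of_nat (2 * l + 1 + 1)) *
      z ^ (k - 3 - (2 * l + 1)) = Lambda_const k * fact (k - 2) *
      (Lambda_quotient k m (of_nat (2 * l + 2)) * (- (z ^ 2)) ^ (2 * N - l))"
      unfolding bin by (simp only: s_def mult_1)
  qed
  finally show ?thesis by (simp only: sum_distrib_left)
qed

text \<open>For \<open>k = 4\<close> only \<open>n = 1\<close> occurs, and the polynomial is a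
  constant multiple of the value of \<open>Lambda_quotient\<close> at the centre
  \<open>s = 2\<close>. For odd \<open>m\<close> this value is 0 by reflection, so the polynomial
  vanishes identically and every \<open>z\<close> is a zero; that case is excluded.\<close>

theorem theorem4p2:
  fixes k m :: nat
  assumes "k > 0" and "[k = 0] (mod 4)" and "m \<ge> 1"
    and nondegenerate: "\<not> (k = 4 \<and> odd m)"
  shows "\<forall>z. period_poly_deriv (eisenstein_E k) k m z = 0 \<longrightarrow> norm z = 1"
proof (intro allI impI)
  fix z assume zero: "period_poly_deriv (eisenstein_E k) k m z = 0"
  have "4 dvd k" using assms(2) by (simp add: cong_0_iff)
  then obtain q where "k = 4 * q" by (elim dvdE)
  then obtain N where N: "k = 4 * N + 4" using \<open>k > 0\<close> by (cases q) auto
  have k4: "k \<ge> 4" using N by simp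
  have kh: "real k / 2 = 2 * real N + 2" by (simp add: N)
  let ?c = "complex_of_real (real k / 2)"
  define Q where "Q = Lambda_quotient k m"
  \<comment> \<open>The centre \<open>k / 2 = 2 * N + 2\<close> corresponds to \<open>j = N\<close>,
    the middle of the \<open>2 * N + 1\<close> coefficients.\<close>
  define a where "a = (\<lambda>j. Re (Q (of_nat (2 * j + 2))))"
  define w where "w = - (z ^ 2)"
  have shift: "complex_of_nat (2 * (N + i) + 2) = ?c + of_real (2 * real i)" for i
    unfolding kh by simp
  have range: "2 * real i < real k / 2 - 1" if "i \<le> N" for i
    using that unfolding kh by simp
  have reflect: "Q (of_nat (2 * (2 * N - j) + 2)) = (-1) ^ m * Q (of_nat (2 * j + 2))" if "j \<le> 2 * N" for j
  proof -
    have "complex_of_nat (2 * j + 2) - ?c = of_real (2 * real j - 2 * real N)"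
      unfolding kh by simp
    moreover have "\<bar>2 * real j - 2 * real N\<bar> < real k / 2 - 1"
      using that unfolding kh by (auto simp: abs_if)
    ultimately have "of_nat (2 * j + 2) \<in> ball ?c (real k / 2 - 1)"
      unfolding mem_ball dist_norm norm_minus_commute[of ?c "of_nat (2 * j + 2)"]
      by (simp only: norm_of_real)
    moreover have "complex_of_nat (2 * (2 * N - j) + 2) = of_real (real k) - of_nat (2 * j + 2)"
      using that by (simp add: N of_nat_diff)
    ultimately show ?thesis
      unfolding Q_def using Lambda_quotient_reflect[OF k4] by metis
  qed
  have upper: "Q (of_nat (2 * (N + i) + 2)) \<in> \<real>\<^sub>\<ge>\<^sub>0" if "i \<le> N" for i
    unfolding shift Q_def
    using abs_monotone_at_nonneg(1)[OF Lambda_quotient_abs_monotone[OF k4], of "2 * real i" m] range[OF that]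
    by simp
  have real_upper: "Q (of_nat (2 * j + 2)) = of_real (a j)" if "N \<le> j" "j \<le> 2 * N" for j
    using upper[of "j - N"] that by (simp add: a_def complex_nonneg_Reals_iff complex_eq_iff)
  have sym: "a (2 * N - j) = (-1) ^ m * a j" if "j \<le> 2 * N" for j
    using reflect[OF that] by (cases "even m") (simp_all add: a_def)
  have Q_real: "Q (of_nat (2 * j + 2)) = of_real (a j)" if "j \<le> 2 * N" for j
  proof (cases "N \<le> j")
    case False
    have "Q (of_nat (2 * j + 2)) = (-1) ^ m * Q (of_nat (2 * (2 * N - j) + 2))"
      using reflect[of "2 * N - j"] that by simp
    also have "\<dots> = of_real ((-1) ^ m * a (2 * N - j))"
      using real_upper[of "2 * N - j"] False by simp
    also have "(-1) ^ m * a (2 * N - j) = a j"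
      using sym[of "2 * N - j"] that by simp
    finally show ?thesis .
  qed (use real_upper that in blast)
  have "Lambda_const k * fact (k - 2) \<noteq> 0"
    using Lambda_const_nonzero[of k] k4 by simp
  hence "(\<Sum>l\<le>2 * N. Q (of_nat (2 * l + 2)) * w ^ (2 * N - l)) = 0"
    using zero unfolding period_poly_deriv_eisenstein[OF N] Q_def w_def by simp
  also have "(\<Sum>l\<le>2 * N. Q (of_nat (2 * l + 2)) * w ^ (2 * N - l)) = (\<Sum>l\<le>2 * N. of_real (a l) * w ^ (2 * N - l))"
    by (intro sum.cong) (auto simp: Q_real[simplified])
  also have "\<dots> = (\<Sum>j\<le>2 * N. of_real (a (2 * N - j)) * w ^ j)"
    by (rule sum.reindex_bij_witness[of _ "\<lambda>j. 2 * N - j" "\<lambda>j. 2 * N - j"]) auto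
  also have "\<dots> = (-1) ^ m * (\<Sum>j\<le>2 * N. of_real (a j) * w ^ j)"
    by (simp add: sym sum_distrib_left mult.assoc)
  finally have zero': "(\<Sum>j\<le>2 * N. of_real (a j) * w ^ j) = 0" by simp
  have "norm w = 1"
  proof (rule zeros_on_circle_if_coeffs_increase_from_middle[OF sym _ _ _ _ zero'])
    show "a (N + i) \<le> a (N + Suc i)" if "i < N" for i
      unfolding a_def shift Q_def
      using abs_monotone_at_nonneg(2)[OF Lambda_quotient_abs_monotone[OF k4], of "2 * real i" "2 * real (Suc i)" m]
        range[of i] range[of "Suc i"] that by simp
    show "0 \<le> a N"
      using upper[of 0] by (simp add: a_def complex_nonneg_Reals_iff)
    show "0 < a (2 * N)"
    proof (cases "N = 0")
      case True
      hence "even m" using nondegenerate N by simp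
      from Lambda_quotient_even_pos[OF k4 this] show ?thesis
        using shift[of 0] True by (simp add: a_def Q_def)
    next
      case False
      hence "Re (Q (?c + of_real (2 * real N))) > 0"
        unfolding Q_def using range[of N] by (intro Lambda_quotient_pos[OF k4]) auto
      moreover have "a (N + N) = Re (Q (?c + of_real (2 * real N)))"
        unfolding a_def shift ..
      ultimately show ?thesis by (simp only: mult_2)
    qed
  qed simp_all
  hence "norm z ^ 2 = 1 ^ 2" by (simp add: w_def norm_power)
  thus "norm z = 1" by (rule power_eq_imp_eq_base) simp_all
qed

end
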